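(* Let $d,n\in\mathbb N$. For $j\in\{1,\dots,n\}$ and $r\in\{1,\dots,d\}$ let $p_j,q_{j,r}\in[0,1]$ be such that $\sum_{r=1}^d q_{j,r}=1$ for all $j$ and $\lambda_r:=\sum_{j=1}^n p_jq_{j,r}>0$ for all $r$. Set $\lambda=\sum_{j=1}^n p_j$ and let $e_r\in\mathbb R^d$ be the $r$-th standard unit vector. Consider the probability measures on $\mathbb R^d$ $$F=\prod_{j=1}^n\Bigl(\delta_0+p_j\sum_{r=1}^d q_{j,r}(\delta_{e_r}-\delta_0)\Bigr),\qquad G=\exp\Bigl(\sum_{r=1}^d\lambda_r(\delta_{e_r}-\delta_0)\Bigr)$$ (products and exponentials in the convolution sense; so $F$ is a generalized multinomial distribution and $G=\bigotimes_{r=1}^d\mathrm{Po}(\lambda_r)$). Let $g(z)=2\sum_{m=2}^\infty\frac{m-1}{m!}z^{m-2}$ and $$\alpha_1=\sum_{j=1}^n g(2p_j)\,p_j^2\sum_{r=1}^d q_{j,r}\min\Bigl\{\frac{q_{j,r}}{2^{3/2}\lambda_r},\,2\Bigr\},\qquad \beta_1=\sum_{j=1}^n p_j^2\sum_{r=1}^d q_{j,r}\min\Bigl\{\frac{q_{j,r}}{\lambda_r},\,1\Bigr\}.$$ If $\alpha_1<\frac{1}{2^{3/2}}$, then $$\|F-G\|\le\frac{2\alpha_1}{1-2^{3/2}\alpha_1}.$$ Without any restrictions, $$\|F-G\|\le 15.6\,\beta_1.$$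
   Context: All measures are finite signed measures on $(\mathbb R^d,\mathcal B^d)$ with $\mathcal B^d$ the Borel $\sigma$-algebra. $\delta_x$ is the Dirac measure at $x$. Products and powers of finite signed measures are convolutions, with empty products and zeroth powers equal to $\delta_0$; $\exp(V)=\sum_{m=0}^\infty V^m/m!$ for a finite signed measure $V$ (convergent in total variation norm). $\|V\|=|V|(\mathbb R^d)=V^+(\mathbb R^d)+V^-(\mathbb R^d)$ is the total variation norm, where $V=V^+-V^-$ is the Hahn-Jordan decomposition. $\mathrm{Po}(t)$ is the Poisson distribution with mean $t$. The function $g$ satisfies $g(z)=\frac{2e^z}{z^2}(e^{-z}-1+z)$ for $z\in\mathbb C\setminus\{0\}$ and $g(0)=1$. *)

theory Defs
  imports "HOL-Probability.Probability"
begin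

subsection \<open>Finite signed measures on the Borel sets\<close>

text \<open>
  A finite signed measure is a real-valued countably additive function on the Borel sets. It is
  extended by \<open>0\<close> to all other sets, so that equality on Borel sets is equality.
\<close>

definition is_signed_measure :: "('a::topological_space set \<Rightarrow> real) \<Rightarrow> bool" where
  "is_signed_measure V \<longleftrightarrow>
     (\<forall>A. A \<notin> sets borel \<longrightarrow> V A = 0) \<and>
     (\<forall>A::nat \<Rightarrow> 'a set. range A \<subseteq> sets borel \<longrightarrow> disjoint_family A \<longrightarrow>
        (\<lambda>i. V (A i)) sums V (\<Union>i. A i))"

typedef (overloaded) ('a::topological_space) signed_measure = "{V :: 'a set \<Rightarrow> real. is_signed_measure V}"
  morphisms sm_apply Abs_signed_measure
  by (rule exI[of _ "\<lambda>_. 0"]) (simp add: is_signed_measure_def)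

setup_lifting type_definition_signed_measure

lemma is_signed_measure_sm_apply: "is_signed_measure (sm_apply V)"
  using sm_apply[of V] by simp

lemma is_signed_measure_add:
  assumes "is_signed_measure V" "is_signed_measure W"
  shows "is_signed_measure (\<lambda>A. V A + W A)"
  using assms unfolding is_signed_measure_def by (auto intro!: sums_add)

lemma is_signed_measure_scale:
  assumes "is_signed_measure V"
  shows "is_signed_measure (\<lambda>A. c * V A)"
  using assms unfolding is_signed_measure_def by (auto intro!: sums_mult)

instantiation signed_measure :: (topological_space) real_vector
begin

lift_definition zero_signed_measure :: "'a signed_measure" is "\<lambda>_. 0"
  by (simp add: is_signed_measure_def)

lift_definition plus_signed_measure :: "'a signed_measure \<Rightarrow> 'a signed_measure \<Rightarrow> 'a signed_measure"
  is "\<lambda>V W A. V A + W A"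
  by (rule is_signed_measure_add)

lift_definition uminus_signed_measure :: "'a signed_measure \<Rightarrow> 'a signed_measure"
  is "\<lambda>V A. - V A"
  using is_signed_measure_scale[of _ "-1"] by simp

lift_definition minus_signed_measure :: "'a signed_measure \<Rightarrow> 'a signed_measure \<Rightarrow> 'a signed_measure"
  is "\<lambda>V W A. V A - W A"
  subgoal for V W
    using is_signed_measure_add[of V "\<lambda>A. (-1) * W A"] is_signed_measure_scale[of W "-1"] by simp
  done

lift_definition scaleR_signed_measure :: "real \<Rightarrow> 'a signed_measure \<Rightarrow> 'a signed_measure"
  is "\<lambda>c V A. c * V A"
  by (rule is_signed_measure_scale)

instance
  by standard (transfer; auto simp: fun_eq_iff algebra_simps)+

end

lemmas sm_apply_simps [simp] =
  zero_signed_measure.rep_eq plus_signed_measure.rep_eq uminus_signed_measure.rep_eq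
  minus_signed_measure.rep_eq scaleR_signed_measure.rep_eq

lemma sm_eqI: "(\<And>A. A \<in> sets borel \<Longrightarrow> sm_apply V A = sm_apply W A) \<Longrightarrow> V = W"
  by (rule sm_apply_inject[THEN iffD1], rule ext)
     (metis is_signed_measure_sm_apply is_signed_measure_def)

lemma ism_sums:
  assumes "is_signed_measure V" "range A \<subseteq> sets borel" "disjoint_family A"
  shows "(\<lambda>i. V (A i)) sums V (\<Union>i::nat. A i)"
  using assms unfolding is_signed_measure_def by blast

lemma ism_empty:
  assumes "is_signed_measure V"
  shows "V {} = 0"
proof -
  have "(\<lambda>i::nat. V {}) sums V {}"
    using ism_sums[OF assms, of "\<lambda>_. {}"] by (simp add: disjoint_family_on_def)
  then show ?thesis
    using sums_summable summable_const_iff by blast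
qed

lemma ism_Un:
  assumes "is_signed_measure V" "A \<in> sets borel" "B \<in> sets borel" "A \<inter> B = {}"
  shows "V (A \<union> B) = V A + V B"
proof -
  have "(\<lambda>i. V (binaryset A B i)) sums V (\<Union>i. binaryset A B i)"
    using assms by (intro ism_sums) (auto simp: binaryset_def disjoint_family_on_def)
  moreover have "(\<lambda>i. V (binaryset A B i)) sums (V A + V B)"
    by (rule binaryset_sums) (rule ism_empty[OF assms(1)])
  ultimately show ?thesis
    using sums_unique2 UN_binaryset_eq by metis
qed

lemma ism_Diff:
  assumes "is_signed_measure V" "A \<in> sets borel" "B \<in> sets borel" "B \<subseteq> A"
  shows "V (A - B) = V A - V B"
  using ism_Un[of V B "A - B"] assms by (simp add: Un_absorb1)

lemma ism_Int_Diff: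
  assumes "is_signed_measure V" "A \<in> sets borel" "B \<in> sets borel"
  shows "V A = V (A \<inter> B) + V (A - B)"
proof -
  have "A = (A \<inter> B) \<union> (A - B)" by auto
  then show ?thesis
    using ism_Un[of V "A \<inter> B" "A - B"] assms by (metis Diff_disjoint Int_Diff_disjoint sets.Int sets.Diff)
qed

lemma disjoint_family_lessThan_Int:
  assumes "disjoint_family A"
  shows "(\<Union>i<k::nat. A i) \<inter> A k = {}"
proof -
  have "A i \<inter> A k = {}" if "i < k" for i
    using disjoint_family_onD[OF assms, of i k] that by simp
  then show ?thesis by auto
qed

lemma ism_finite_Union:
  assumes V: "is_signed_measure V" and A: "range A \<subseteq> sets borel" "disjoint_family A"
  shows "V (\<Union>i<k::nat. A i) = (\<Sum>i<k. V (A i))"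
proof (induction k)
  case 0
  then show ?case using ism_empty[OF V] by simp
next
  case (Suc k)
  have "(\<Union>i<k. A i) \<inter> A k = {}"
    by (rule disjoint_family_lessThan_Int[OF A(2)])
  then have "V ((\<Union>i<k. A i) \<union> A k) = V (\<Union>i<k. A i) + V (A k)"
    using A(1) by (intro ism_Un[OF V]) auto
  then show ?case using Suc by (simp add: lessThan_Suc Un_commute add.commute)
qed

lemma ism_bounded:
  fixes V :: "'a::topological_space set \<Rightarrow> real"
  assumes V: "is_signed_measure V"
  shows "\<exists>r. \<forall>A\<in>sets borel. \<bar>V A\<bar> \<le> r"
proof (rule ccontr)
  assume nb: "\<not> ?thesis"
  define U where "U A \<longleftrightarrow> A \<in> sets borel \<and> (\<forall>r. \<exists>B\<in>sets borel. B \<subseteq> A \<and> r < \<bar>V B\<bar>)" for A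
  have U0: "U UNIV"
    using nb by (auto simp: U_def not_le)
  have step: "\<exists>C. U C \<and> C \<subseteq> A \<and> 1 \<le> \<bar>V (A - C)\<bar>" if A: "U A" for A
  proof -
    have Ab: "A \<in> sets borel" using A by (simp add: U_def)
    obtain B where B: "B \<in> sets borel" "B \<subseteq> A" "\<bar>V A\<bar> + 1 < \<bar>V B\<bar>"
      using A unfolding U_def by blast
    have d: "V (A - B) = V A - V B"
      using ism_Diff[OF V Ab B(1,2)] .
    have AB: "A - B \<in> sets borel" using Ab B by auto
    show ?thesis
    proof (cases "U B")
      case True
      then show ?thesis using B d by (intro exI[of _ B]) auto
    next
      case nB: False
      then obtain r where r: "\<And>C. C \<in> sets borel \<Longrightarrow> C \<subseteq> B \<Longrightarrow> \<bar>V C\<bar> \<le> r"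
        using B by (auto simp: U_def not_less)
      have "U (A - B)"
        unfolding U_def
      proof (intro conjI allI AB)
        fix s
        obtain C where C: "C \<in> sets borel" "C \<subseteq> A" "r + s < \<bar>V C\<bar>"
          using A unfolding U_def by blast
        have "V C = V (C \<inter> B) + V (C - B)"
          using ism_Int_Diff[OF V C(1) B(1)] .
        moreover have "\<bar>V (C \<inter> B)\<bar> \<le> r"
          using C B by (intro r) auto
        ultimately have "s < \<bar>V (C - B)\<bar>" using C by linarith
        then show "\<exists>D\<in>sets borel. D \<subseteq> A - B \<and> s < \<bar>V D\<bar>"
          using C B by (intro bexI[of _ "C - B"]) auto
      qed
      moreover have "A - (A - B) = B" using B by auto
      ultimately show ?thesis using B by (intro exI[of _ "A - B"]) auto
    qed
  qed
  have "\<exists>f. \<forall>n::nat. U (f n) \<and> (f (Suc n) \<subseteq> f n \<and> 1 \<le> \<bar>V (f n - f (Suc n))\<bar>)"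
    using U0 step by (intro dependent_nat_choice) auto
  then obtain f where f: "\<And>n. U (f n)" "\<And>n. f (Suc n) \<subseteq> f n" "\<And>n::nat. 1 \<le> \<bar>V (f n - f (Suc n))\<bar>"
    by blast
  have dec: "m \<le> n \<Longrightarrow> f n \<subseteq> f m" for m n
    using f(2) lift_Suc_antimono_le[of f] by blast
  have "disjoint_family (\<lambda>n. f n - f (Suc n))"
  proof -
    have "(f m - f (Suc m)) \<inter> (f n - f (Suc n)) = {}" if "m < n" for m n
      using dec[of "Suc m" n] that by auto
    then show ?thesis
      unfolding disjoint_family_on_def by (metis Int_commute linorder_neqE_nat)
  qed
  then have "(\<lambda>n. V (f n - f (Suc n))) sums V (\<Union>n. f n - f (Suc n))"
    using f(1) by (intro ism_sums[OF V]) (auto simp: U_def)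
  then have "(\<lambda>n. V (f n - f (Suc n))) \<longlonglongrightarrow> 0"
    by (rule sums_summable[THEN summable_LIMSEQ_zero])
  then have "eventually (\<lambda>n. \<bar>V (f n - f (Suc n))\<bar> < 1) sequentially"
    by (intro order_tendstoD(2)[OF tendsto_rabs_zero zero_less_one])
  then obtain n where "\<bar>V (f n - f (Suc n))\<bar> < 1"
    by (auto simp: eventually_sequentially)
  with f(3)[of n] show False by simp
qed

lemma measure_of_real:
  fixes m :: "'a::topological_space set \<Rightarrow> real"
  assumes "\<forall>A\<in>sets borel. 0 \<le> m A"
    and "\<forall>A::nat \<Rightarrow> 'a set. range A \<subseteq> sets borel \<longrightarrow> disjoint_family A \<longrightarrow> (\<lambda>i. m (A i)) sums m (\<Union>i. A i)"
    and M_def: "M = measure_of UNIV (sets borel) (\<lambda>A. ennreal (m A))"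
  shows "finite_measure M" "sets M = sets borel" "space M = UNIV"
    "\<And>A. A \<in> sets borel \<Longrightarrow> measure M A = m A"
    "\<And>A. A \<in> sets borel \<Longrightarrow> emeasure M A = ennreal (m A)"
proof -
  have sb: "sigma_sets UNIV (sets borel) = sets (borel :: 'a measure)"
    using sets.sigma_sets_eq[of "borel :: 'a measure"] by simp
  show s: "sets M = sets borel" "space M = UNIV"
    by (simp_all add: M_def sb)
  have "m {} = 0"
  proof -
    have "(\<lambda>i::nat. m {}) sums m {}"
      using assms(2)[rule_format, of "\<lambda>_. {}"] by (simp add: disjoint_family_on_def)
    then show ?thesis
      using sums_summable summable_const_iff by blast
  qed
  show e: "emeasure M A = ennreal (m A)" if "A \<in> sets borel" for A
  proof (rule emeasure_measure_of[OF M_def])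
    show "positive (sets M) (\<lambda>A. ennreal (m A))"
      using \<open>m {} = 0\<close> by (simp add: positive_def)
    show "countably_additive (sets M) (\<lambda>A. ennreal (m A))"
      unfolding countably_additive_def s
      by (intro allI impI suminf_ennreal_eq assms(1,2)[rule_format]) auto
  qed (use that s in auto)
  show "measure M A = m A" if "A \<in> sets borel" for A
    using e[OF that] assms(1) that by (simp add: measure_def)
  show "finite_measure M"
    using e[of UNIV] by (intro finite_measureI) (simp add: s)
qed

subsection \<open>Hahn-Jordan decomposition and total variation norm\<close>

definition is_hahn_set :: "'a::topological_space signed_measure \<Rightarrow> 'a set \<Rightarrow> bool" where
  "is_hahn_set V P \<longleftrightarrow> P \<in> sets borel \<and>
     (\<forall>A\<in>sets borel. A \<subseteq> P \<longrightarrow> 0 \<le> sm_apply V A) \<and>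
     (\<forall>A\<in>sets borel. A \<subseteq> - P \<longrightarrow> sm_apply V A \<le> 0)"

definition hahn_set :: "'a::topological_space signed_measure \<Rightarrow> 'a set" where
  "hahn_set V = (SOME P. is_hahn_set V P)"

definition pos_part :: "'a::topological_space signed_measure \<Rightarrow> 'a measure" where
  "pos_part V = measure_of UNIV (sets borel) (\<lambda>A. ennreal (sm_apply V (A \<inter> hahn_set V)))"

definition neg_part :: "'a::topological_space signed_measure \<Rightarrow> 'a measure" where
  "neg_part V = measure_of UNIV (sets borel) (\<lambda>A. ennreal (- sm_apply V (A - hahn_set V)))"

theorem hahn_set_exists: "\<exists>P. is_hahn_set V P"
proof -
  define v where "v = sm_apply V"
  have V: "is_signed_measure v"
    by (simp add: v_def is_signed_measure_sm_apply)
  obtain r where r: "\<And>A. A \<in> sets borel \<Longrightarrow> \<bar>v A\<bar> \<le> r"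
    using ism_bounded[OF V] by blast
  define m where "m A = (SUP B\<in>{B\<in>sets borel. B \<subseteq> A}. v B)" for A
  have bdd: "bdd_above (v ` {B\<in>sets borel. B \<subseteq> A})" for A
    using r by (intro bdd_aboveI2[where M = r]) (auto simp: abs_le_iff)
  have up: "v B \<le> m A" if "B \<in> sets borel" "B \<subseteq> A" for A B
    unfolding m_def using that by (intro cSUP_upper bdd) auto
  have least: "m A \<le> c" if "\<And>B. B \<in> sets borel \<Longrightarrow> B \<subseteq> A \<Longrightarrow> v B \<le> c" for A c
    unfolding m_def using that by (intro cSUP_least) auto
  have m0: "0 \<le> m A" for A
    using up[of "{}" A] ism_empty[OF V] by simp
  have mono: "m A \<le> m B" if "A \<subseteq> B" for A B
    using that by (intro least up) auto
  have add: "m A + m B \<le> m (A \<union> B)" if "A \<inter> B = {}" for A B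
  proof -
    have "v C + v D \<le> m (A \<union> B)" if "C \<in> sets borel" "C \<subseteq> A" "D \<in> sets borel" "D \<subseteq> B" for C D
      using ism_Un[OF V, of C D] up[of "C \<union> D" "A \<union> B"] that \<open>A \<inter> B = {}\<close> by fastforce
    then have "m A \<le> m (A \<union> B) - v D" if "D \<in> sets borel" "D \<subseteq> B" for D
      using that by (intro least) (auto simp: le_diff_eq)
    then have "m B \<le> m (A \<union> B) - m A"
      by (intro least) (auto simp: le_diff_eq add.commute)
    then show ?thesis by simp
  qed
  have msums: "(\<lambda>i. m (A i)) sums m (\<Union>i. A i)"
    if A: "range A \<subseteq> sets borel" "disjoint_family A" for A :: "nat \<Rightarrow> 'a set"
  proof -
    have fin: "(\<Sum>i<k. m (A i)) \<le> m (\<Union>i<k. A i)" for k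
    proof (induction k)
      case (Suc k)
      have "(\<Union>i<k. A i) \<inter> A k = {}"
        by (rule disjoint_family_lessThan_Int[OF A(2)])
      from add[OF this] Suc show ?case
        by (simp add: lessThan_Suc Un_commute add.commute)
    qed (simp add: m0)
    then have fin': "(\<Sum>i<k. m (A i)) \<le> m (\<Union>i. A i)" for k
      by (rule order_trans) (auto intro!: mono)
    have sm: "summable (\<lambda>i. m (A i))"
      using m0 fin' by (rule summableI_nonneg_bounded)
    have "m (\<Union>i. A i) \<le> (\<Sum>i. m (A i))"
    proof (rule least)
      fix B assume B: "B \<in> sets borel" "B \<subseteq> (\<Union>i. A i)"
      have "(\<lambda>i. v (B \<inter> A i)) sums v (\<Union>i. B \<inter> A i)"
        using A B by (intro ism_sums[OF V]) (auto simp: disjoint_family_on_def)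
      moreover have "(\<Union>i. B \<inter> A i) = B" using B(2) by blast
      ultimately have s1: "(\<lambda>i. v (B \<inter> A i)) sums v B" by simp
      have s2: "(\<lambda>i. m (A i)) sums (\<Sum>i. m (A i))"
        using sm by (rule summable_sums)
      have "v (B \<inter> A i) \<le> m (A i)" for i
        using A(1) B(1) by (intro up) auto
      then show "v B \<le> (\<Sum>i. m (A i))"
        using s1 s2 by (rule sums_le)
    qed
    moreover have "(\<Sum>i. m (A i)) \<le> m (\<Union>i. A i)"
      using sm fin' by (rule suminf_le_const)
    ultimately have "(\<Sum>i. m (A i)) = m (\<Union>i. A i)" by linarith
    then show ?thesis
      using summable_sums[OF sm] by simp
  qed
  define M where "M = measure_of UNIV (sets borel) (\<lambda>A. ennreal (m A))"
  define N where "N = measure_of UNIV (sets borel) (\<lambda>A. ennreal (m A - v A))"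
  have M1: "\<forall>A\<in>sets borel. 0 \<le> m A"
    and M2: "\<forall>A::nat \<Rightarrow> 'a set. range A \<subseteq> sets borel \<longrightarrow> disjoint_family A \<longrightarrow> (\<lambda>i. m (A i)) sums m (\<Union>i. A i)"
    using m0 msums by blast+
  note M = measure_of_real[OF M1 M2 M_def]
  have N1: "\<forall>A\<in>sets borel. 0 \<le> m A - v A"
    using up by simp
  have N2: "\<forall>A::nat \<Rightarrow> 'a set. range A \<subseteq> sets borel \<longrightarrow> disjoint_family A \<longrightarrow>
      (\<lambda>i. m (A i) - v (A i)) sums (m (\<Union>i. A i) - v (\<Union>i. A i))"
    using msums ism_sums[OF V] by (intro allI impI sums_diff)
  note N = measure_of_real[of "\<lambda>A. m A - v A", OF N1 N2 N_def]
  have "\<exists>Y\<in>sets M. (\<forall>X\<in>sets M. X \<subseteq> Y \<longrightarrow> emeasure N X \<le> emeasure M X) \<and>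
      (\<forall>X\<in>sets M. X \<inter> Y = {} \<longrightarrow> emeasure M X \<le> emeasure N X)"
    using M(1,2) N(1,2) by (intro finite_unsigned_Hahn_decomposition) auto
  then obtain Y where Y: "Y \<in> sets borel"
    "\<And>X. X \<in> sets borel \<Longrightarrow> X \<subseteq> Y \<Longrightarrow> ennreal (m X - v X) \<le> ennreal (m X)"
    "\<And>X. X \<in> sets borel \<Longrightarrow> X \<inter> Y = {} \<Longrightarrow> ennreal (m X) \<le> ennreal (m X - v X)"
    using M N by auto
  have "0 \<le> v X" if "X \<in> sets borel" "X \<subseteq> Y" for X
    using Y(2)[OF that] m0[of X] by (simp add: ennreal_le_iff)
  moreover have "v X \<le> 0" if "X \<in> sets borel" "X \<subseteq> - Y" for X
  proof -
    have "X \<inter> Y = {}" using that by auto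
    from Y(3)[OF that(1) this] N1 that(1) show ?thesis by (simp add: ennreal_le_iff)
  qed
  ultimately have "is_hahn_set V Y"
    using Y(1) by (simp add: is_hahn_set_def v_def)
  then show ?thesis ..
qed

lemma hahn_set: "is_hahn_set V (hahn_set V)"
  unfolding hahn_set_def by (rule someI_ex) (rule hahn_set_exists)

lemma hahn_set_borel [measurable, simp]: "hahn_set V \<in> sets borel"
  using hahn_set[of V] by (simp add: is_hahn_set_def)

lemma hahn_set_pos: "A \<in> sets borel \<Longrightarrow> A \<subseteq> hahn_set V \<Longrightarrow> 0 \<le> sm_apply V A"
  using hahn_set[of V] by (simp add: is_hahn_set_def)

lemma hahn_set_neg: "A \<in> sets borel \<Longrightarrow> A \<subseteq> - hahn_set V \<Longrightarrow> sm_apply V A \<le> 0"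
  using hahn_set[of V] by (simp add: is_hahn_set_def)

lemma
  shows finite_pos_part [simp]: "finite_measure (pos_part V)"
    and sets_pos_part [simp, measurable_cong]: "sets (pos_part V) = sets borel"
    and space_pos_part [simp]: "space (pos_part V) = UNIV"
    and measure_pos_part: "A \<in> sets borel \<Longrightarrow> measure (pos_part V) A = sm_apply V (A \<inter> hahn_set V)"
proof -
  have 1: "\<forall>A\<in>sets borel. 0 \<le> sm_apply V (A \<inter> hahn_set V)"
    by (intro ballI hahn_set_pos) auto
  have 2: "\<forall>A::nat \<Rightarrow> 'a set. range A \<subseteq> sets borel \<longrightarrow> disjoint_family A \<longrightarrow>
      (\<lambda>i. sm_apply V (A i \<inter> hahn_set V)) sums sm_apply V ((\<Union>i. A i) \<inter> hahn_set V)"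
  proof (intro allI impI)
    fix A :: "nat \<Rightarrow> 'a set" assume that: "range A \<subseteq> sets borel" "disjoint_family A"
    have "(\<lambda>i. sm_apply V (A i \<inter> hahn_set V)) sums sm_apply V (\<Union>i. A i \<inter> hahn_set V)"
      using that by (intro ism_sums is_signed_measure_sm_apply) (auto simp: disjoint_family_on_def)
    then show "(\<lambda>i. sm_apply V (A i \<inter> hahn_set V)) sums sm_apply V ((\<Union>i. A i) \<inter> hahn_set V)" by simp
  qed
  note * = measure_of_real[of "\<lambda>A. sm_apply V (A \<inter> hahn_set V)", OF 1 2 pos_part_def]
  show "finite_measure (pos_part V)" "sets (pos_part V) = sets borel" "space (pos_part V) = UNIV"
    by (fact *)+
  show "A \<in> sets borel \<Longrightarrow> measure (pos_part V) A = sm_apply V (A \<inter> hahn_set V)"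
    by (rule *)
qed

lemma
  shows finite_neg_part [simp]: "finite_measure (neg_part V)"
    and sets_neg_part [simp, measurable_cong]: "sets (neg_part V) = sets borel"
    and space_neg_part [simp]: "space (neg_part V) = UNIV"
    and measure_neg_part: "A \<in> sets borel \<Longrightarrow> measure (neg_part V) A = - sm_apply V (A - hahn_set V)"
proof -
  have 1: "\<forall>A\<in>sets borel. 0 \<le> - sm_apply V (A - hahn_set V)"
  proof
    fix A :: "'a set" assume "A \<in> sets borel"
    then show "0 \<le> - sm_apply V (A - hahn_set V)"
      using hahn_set_neg[of "A - hahn_set V" V] by auto
  qed
  have 2: "\<forall>A::nat \<Rightarrow> 'a set. range A \<subseteq> sets borel \<longrightarrow> disjoint_family A \<longrightarrow>
      (\<lambda>i. - sm_apply V (A i - hahn_set V)) sums - sm_apply V ((\<Union>i. A i) - hahn_set V)"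
  proof (intro allI impI)
    fix A :: "nat \<Rightarrow> 'a set" assume that: "range A \<subseteq> sets borel" "disjoint_family A"
    have "(\<lambda>i. sm_apply V (A i - hahn_set V)) sums sm_apply V (\<Union>i. A i - hahn_set V)"
      using that by (intro ism_sums is_signed_measure_sm_apply) (auto simp: disjoint_family_on_def)
    moreover have "(\<Union>i. A i - hahn_set V) = (\<Union>i. A i) - hahn_set V" by auto
    ultimately show "(\<lambda>i. - sm_apply V (A i - hahn_set V)) sums - sm_apply V ((\<Union>i. A i) - hahn_set V)"
      by (simp add: sums_minus)
  qed
  note * = measure_of_real[of "\<lambda>A. - sm_apply V (A - hahn_set V)", OF 1 2 neg_part_def]
  show "finite_measure (neg_part V)" "sets (neg_part V) = sets borel" "space (neg_part V) = UNIV"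
    by (fact *)+
  show "A \<in> sets borel \<Longrightarrow> measure (neg_part V) A = - sm_apply V (A - hahn_set V)"
    by (rule *)
qed

lemma jordan_decomposition:
  "A \<in> sets borel \<Longrightarrow> sm_apply V A = measure (pos_part V) A - measure (neg_part V) A"
  using ism_Int_Diff[OF is_signed_measure_sm_apply, of A "hahn_set V" V]
  by (simp add: measure_pos_part measure_neg_part)

instantiation signed_measure :: (topological_space) real_normed_vector
begin

definition norm_signed_measure :: "'a signed_measure \<Rightarrow> real" where
  "norm_signed_measure V = measure (pos_part V) UNIV + measure (neg_part V) UNIV"

definition dist_signed_measure :: "'a signed_measure \<Rightarrow> 'a signed_measure \<Rightarrow> real" where
  "dist_signed_measure V W = norm (V - W)"

definition sgn_signed_measure :: "'a signed_measure \<Rightarrow> 'a signed_measure" where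
  "sgn_signed_measure V = inverse (norm V) *\<^sub>R V"

definition uniformity_signed_measure :: "('a signed_measure \<times> 'a signed_measure) filter" where
  "uniformity_signed_measure = (INF e\<in>{0 <..}. principal {(V, W). dist V W < e})"

definition open_signed_measure :: "'a signed_measure set \<Rightarrow> bool" where
  "open_signed_measure S = (\<forall>V\<in>S. \<forall>\<^sub>F (V', W) in uniformity. V' = V \<longrightarrow> W \<in> S)"

lemma norm_sm_hahn: "norm V = sm_apply V (hahn_set V) - sm_apply V (- hahn_set V)"
  by (simp add: norm_signed_measure_def measure_pos_part measure_neg_part Compl_eq_Diff_UNIV)

lemma norm_sm_ge:
  assumes A: "A \<in> sets borel" and B: "B \<in> sets borel" and "A \<inter> B = {}"
  shows "\<bar>sm_apply V A\<bar> + \<bar>sm_apply V B\<bar> \<le> norm V"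
proof -
  interpret p: finite_measure "pos_part V" by simp
  interpret n: finite_measure "neg_part V" by simp
  have "measure (pos_part V) A + measure (pos_part V) B \<le> measure (pos_part V) UNIV"
    using assms by (subst p.finite_measure_Union[symmetric]) (auto intro!: p.finite_measure_mono)
  moreover have "measure (neg_part V) A + measure (neg_part V) B \<le> measure (neg_part V) UNIV"
    using assms by (subst n.finite_measure_Union[symmetric]) (auto intro!: n.finite_measure_mono)
  ultimately show ?thesis
    using measure_nonneg[of "pos_part V" A] measure_nonneg[of "neg_part V" A]
      measure_nonneg[of "pos_part V" B] measure_nonneg[of "neg_part V" B]
    unfolding norm_signed_measure_def jordan_decomposition[OF A] jordan_decomposition[OF B] by linarith
qed

instance
proof
  fix V W :: "'a signed_measure" and c :: real
  show "dist V W = norm (V - W)" by (rule dist_signed_measure_def)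
  show "sgn V = inverse (norm V) *\<^sub>R V" by (rule sgn_signed_measure_def)
  show "uniformity = (INF e\<in>{0 <..}. principal {(V, W :: 'a signed_measure). dist V W < e})"
    by (rule uniformity_signed_measure_def)
  show "open S = (\<forall>V\<in>S. \<forall>\<^sub>F (V', W) in uniformity. V' = V \<longrightarrow> W \<in> S)" for S :: "'a signed_measure set"
    by (rule open_signed_measure_def)
  show "norm V = 0 \<longleftrightarrow> V = 0"
  proof
    assume "norm V = 0"
    then have "sm_apply V A = 0" if "A \<in> sets borel" for A
      using norm_sm_ge[of A "{}" V] that by simp
    then show "V = 0" by (intro sm_eqI) simp
  qed (simp add: norm_sm_hahn)
  show "norm (V + W) \<le> norm V + norm W"
    using norm_sm_ge[of "hahn_set (V + W)" "- hahn_set (V + W)" V]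
      norm_sm_ge[of "hahn_set (V + W)" "- hahn_set (V + W)" W]
    unfolding norm_sm_hahn[of "V + W"] by (auto simp: abs_le_iff)
  have le: "norm (c *\<^sub>R V) \<le> \<bar>c\<bar> * norm V" for c and V :: "'a signed_measure"
  proof -
    let ?P = "hahn_set (c *\<^sub>R V)"
    have "norm (c *\<^sub>R V) = c * sm_apply V ?P - c * sm_apply V (- ?P)"
      by (simp add: norm_sm_hahn)
    also have "\<dots> \<le> \<bar>c * sm_apply V ?P\<bar> + \<bar>c * sm_apply V (- ?P)\<bar>"
      by linarith
    also have "\<dots> = \<bar>c\<bar> * (\<bar>sm_apply V ?P\<bar> + \<bar>sm_apply V (- ?P)\<bar>)"
      by (simp add: abs_mult algebra_simps)
    also have "\<dots> \<le> \<bar>c\<bar> * norm V"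
      by (intro mult_left_mono norm_sm_ge) auto
    finally show ?thesis .
  qed
  show "norm (c *\<^sub>R V) = \<bar>c\<bar> * norm V"
  proof (cases "c = 0")
    case True
    have "norm (0 :: 'a signed_measure) = 0" by (simp add: norm_sm_hahn)
    with True show ?thesis by simp
  next
    case False
    have "norm V \<le> \<bar>inverse c\<bar> * norm (c *\<^sub>R V)"
      using le[of "inverse c" "c *\<^sub>R V"] False by simp
    then have "\<bar>c\<bar> * norm V \<le> norm (c *\<^sub>R V)"
      using False by (simp add: field_simps abs_inverse)
    with le[of c V] show ?thesis by simp
  qed
qed

end

lemma norm_sm_ge1: "\<bar>sm_apply V A\<bar> \<le> norm V"
proof (cases "A \<in> sets borel")
  case True
  then show ?thesis using norm_sm_ge[of A "{}" V] by simp
next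
  case False
  then have "sm_apply V A = 0"
    using is_signed_measure_sm_apply[of V] by (simp add: is_signed_measure_def)
  then show ?thesis by simp
qed

instance signed_measure :: (topological_space) banach
proof
  fix X :: "nat \<Rightarrow> 'a signed_measure"
  assume X: "Cauchy X"
  have "Cauchy (\<lambda>n. sm_apply (X n) A)" for A
  proof (rule metric_CauchyI)
    fix e :: real assume "0 < e"
    then obtain N where N: "\<And>m n. m \<ge> N \<Longrightarrow> n \<ge> N \<Longrightarrow> dist (X m) (X n) < e"
      using X metric_CauchyD by blast
    have "dist (sm_apply (X m) A) (sm_apply (X n) A) < e" if "m \<ge> N" "n \<ge> N" for m n
      using N[OF that] norm_sm_ge1[of "X m - X n" A] by (simp add: dist_norm)
    then show "\<exists>M. \<forall>m\<ge>M. \<forall>n\<ge>M. dist (sm_apply (X m) A) (sm_apply (X n) A) < e" by blast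
  qed
  then have "\<exists>l. (\<lambda>n. sm_apply (X n) A) \<longlonglongrightarrow> l" for A
    using Cauchy_convergent convergent_def by blast
  then obtain L where L: "\<And>A. (\<lambda>n. sm_apply (X n) A) \<longlonglongrightarrow> L A" by metis
  have unif: "\<exists>N. \<forall>n\<ge>N. \<forall>A\<in>sets borel. \<forall>B\<in>sets borel. A \<inter> B = {} \<longrightarrow>
      \<bar>sm_apply (X n) A - L A\<bar> + \<bar>sm_apply (X n) B - L B\<bar> \<le> e" if e: "0 < e" for e
  proof -
    obtain N where N: "\<And>m n. m \<ge> N \<Longrightarrow> n \<ge> N \<Longrightarrow> dist (X m) (X n) < e"
      using X e metric_CauchyD by blast
    show ?thesis
    proof (intro exI allI impI ballI)
      fix n A B assume n: "n \<ge> N" and AB: "A \<in> sets borel" "B \<in> sets borel" "A \<inter> B = ({} :: 'a set)"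
      have "(\<lambda>m. \<bar>sm_apply (X n) A - sm_apply (X m) A\<bar> + \<bar>sm_apply (X n) B - sm_apply (X m) B\<bar>)
          \<longlonglongrightarrow> \<bar>sm_apply (X n) A - L A\<bar> + \<bar>sm_apply (X n) B - L B\<bar>"
        by (intro tendsto_intros L)
      then show "\<bar>sm_apply (X n) A - L A\<bar> + \<bar>sm_apply (X n) B - L B\<bar> \<le> e"
      proof (rule LIMSEQ_le_const2, intro exI allI impI)
        fix m assume "m \<ge> N"
        then show "\<bar>sm_apply (X n) A - sm_apply (X m) A\<bar> + \<bar>sm_apply (X n) B - sm_apply (X m) B\<bar> \<le> e"
          using N[OF n, of m] norm_sm_ge[OF AB, of "X n - X m"] by (simp add: dist_norm)
      qed
    qed
  qed
  have Lsm: "is_signed_measure L"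
    unfolding is_signed_measure_def
  proof (intro conjI allI impI)
    fix A :: "'a set" assume "A \<notin> sets borel"
    then have "sm_apply (X n) A = 0" for n
      using is_signed_measure_sm_apply[of "X n"] by (simp add: is_signed_measure_def)
    with L[of A] show "L A = 0" by (simp add: LIMSEQ_const_iff)
  next
    fix A :: "nat \<Rightarrow> 'a set" assume A: "range A \<subseteq> sets borel" "disjoint_family A"
    let ?U = "\<Union>i. A i"
    have fin: "L (\<Union>i<k. A i) = (\<Sum>i<k. L (A i))" for k
    proof (rule LIMSEQ_unique[OF L])
      have "(\<lambda>n. \<Sum>i<k. sm_apply (X n) (A i)) \<longlonglongrightarrow> (\<Sum>i<k. L (A i))"
        by (intro tendsto_intros L)
      then show "(\<lambda>n. sm_apply (X n) (\<Union>i<k. A i)) \<longlonglongrightarrow> (\<Sum>i<k. L (A i))"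
        by (simp only: ism_finite_Union[OF is_signed_measure_sm_apply A])
    qed
    show "(\<lambda>i. L (A i)) sums L ?U"
      unfolding sums_def
    proof (rule metric_LIMSEQ_I)
      fix e :: real assume e: "0 < e"
      then obtain N where N0: "\<forall>n\<ge>N. \<forall>A\<in>sets borel. \<forall>B\<in>sets borel. A \<inter> B = {} \<longrightarrow>
          \<bar>sm_apply (X n) A - L A\<bar> + \<bar>sm_apply (X n) B - L B\<bar> \<le> e / 4"
        using unif[of "e / 4"] by auto
      have N: "\<bar>sm_apply (X N) A - L A\<bar> \<le> e / 4" if "A \<in> sets borel" for A
      proof -
        have "\<bar>sm_apply (X N) A - L A\<bar> + \<bar>sm_apply (X N) {} - L {}\<bar> \<le> e / 4"
          using N0 that by blast
        then show ?thesis by linarith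
      qed
      have "(\<lambda>k. \<Sum>i<k. sm_apply (X N) (A i)) \<longlonglongrightarrow> sm_apply (X N) ?U"
        using ism_sums[OF is_signed_measure_sm_apply A] by (simp add: sums_def)
      then obtain K where K: "\<And>k. k \<ge> K \<Longrightarrow> dist (\<Sum>i<k. sm_apply (X N) (A i)) (sm_apply (X N) ?U) < e / 4"
        using e metric_LIMSEQ_D[of _ _ "e / 4"] by (metis divide_pos_pos zero_less_numeral)
      have "dist (\<Sum>i<k. L (A i)) (L ?U) < e" if "k \<ge> K" for k
      proof -
        have "\<bar>sm_apply (X N) (\<Union>i<k. A i) - L (\<Union>i<k. A i)\<bar> \<le> e / 4" "\<bar>sm_apply (X N) ?U - L ?U\<bar> \<le> e / 4"
          using A(1) by (intro N; auto)+
        moreover have "\<bar>sm_apply (X N) (\<Union>i<k. A i) - sm_apply (X N) ?U\<bar> < e / 4"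
          using K[OF that] by (simp add: dist_real_def ism_finite_Union[OF is_signed_measure_sm_apply A])
        ultimately show ?thesis
          using e unfolding fin[symmetric] dist_real_def by linarith
      qed
      then show "\<exists>K. \<forall>k\<ge>K. dist (\<Sum>i<k. L (A i)) (L ?U) < e" by blast
    qed
  qed
  define V where "V = Abs_signed_measure L"
  have V: "sm_apply V = L"
    using Lsm by (simp add: V_def Abs_signed_measure_inverse)
  have "X \<longlonglongrightarrow> V"
  proof (rule metric_LIMSEQ_I)
    fix e :: real assume e: "0 < e"
    then obtain N where N: "\<And>n A B. n \<ge> N \<Longrightarrow> A \<in> sets borel \<Longrightarrow> B \<in> sets borel \<Longrightarrow> A \<inter> B = {} \<Longrightarrow>
        \<bar>sm_apply (X n) A - L A\<bar> + \<bar>sm_apply (X n) B - L B\<bar> \<le> e / 2"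
      using unif[of "e / 2"] by (metis half_gt_zero)
    have "dist (X n) V < e" if "n \<ge> N" for n
      using N[OF that, of "hahn_set (X n - V)" "- hahn_set (X n - V)"] e
      by (simp add: dist_norm norm_sm_hahn V abs_le_iff) (simp add: abs_if split: if_splits)
    then show "\<exists>N. \<forall>n\<ge>N. dist (X n) V < e" by blast
  qed
  then show "convergent X" by (auto simp: convergent_def)
qed

subsection \<open>Convolution\<close>

lift_definition sm_of_measure :: "'a::topological_space measure \<Rightarrow> 'a signed_measure" is
  "\<lambda>M A. if finite_measure M \<and> sets M = sets borel then measure M A else 0"
  subgoal for M
    unfolding is_signed_measure_def if_distrib[where f = "\<lambda>x. _ sums x"]
    by (cases "finite_measure M \<and> sets M = sets borel")
      (simp_all add: measure_notin_sets finite_measure.finite_measure_UNION del: de_Morgan_conj)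
  done

definition dirac :: "'a::topological_space \<Rightarrow> 'a signed_measure" where
  "dirac x = sm_of_measure (return borel x)"

lemma sm_apply_of_measure [simp]:
  "finite_measure M \<Longrightarrow> sets M = sets borel \<Longrightarrow> sm_apply (sm_of_measure M) A = measure M A"
  by (simp add: sm_of_measure.rep_eq)

lemma sm_apply_dirac: "A \<in> sets borel \<Longrightarrow> sm_apply (dirac x) A = indicator A x"
  by (simp add: dirac_def measure_return prob_space.finite_measure prob_space_return)

lemma jordan_decomposition': "V = sm_of_measure (pos_part V) - sm_of_measure (neg_part V)"
  by (rule sm_eqI) (simp add: jordan_decomposition)

lemma
  fixes M :: "'a::topological_space measure"
  assumes M: "finite_measure M" "sets M = sets borel"
  shows pos_part_of_measure: "pos_part (sm_of_measure M) = M"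
    and measure_neg_part_of_measure: "measure (neg_part (sm_of_measure M)) A = 0"
proof -
  interpret M: finite_measure M by fact
  let ?V = "sm_of_measure M"
  interpret p: finite_measure "pos_part ?V" by simp
  have z: "measure M (A - hahn_set ?V) = 0" if "A \<in> sets borel" for A
    using hahn_set_neg[of "A - hahn_set ?V" ?V] that M measure_nonneg[of M "A - hahn_set ?V"]
    by (auto intro: antisym)
  show neg: "measure (neg_part ?V) A = 0" for A
  proof (cases "A \<in> sets borel")
    case True
    then show ?thesis using M z by (simp add: measure_neg_part)
  qed (simp add: measure_notin_sets)
  show "pos_part ?V = M"
  proof (rule measure_eqI)
    fix A assume "A \<in> sets (pos_part ?V)"
    then have "measure (pos_part ?V) A = measure M A"
      using jordan_decomposition[of A ?V] neg[of A] M by simp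
    then show "emeasure (pos_part ?V) A = emeasure M A"
      by (simp add: p.emeasure_eq_measure M.emeasure_eq_measure)
  qed (simp add: M)
qed

lemma measure_convolution:
  fixes M N :: "'a::ordered_euclidean_space measure"
  assumes M [simp]: "finite_measure M" "sets M = sets borel" and N [simp]: "finite_measure N" "sets N = sets borel"
    and A [measurable]: "A \<in> sets borel"
  shows "measure (M \<star> N) A = (\<integral>x. measure N {y. x + y \<in> A} \<partial>M)"
    and "integrable M (\<lambda>x. measure N {y. x + y \<in> A})"
proof -
  interpret M: finite_measure M by fact
  interpret N: finite_measure N by fact
  note [measurable_cong] = M(2) N(2)
  have "(\<lambda>x. emeasure N {y \<in> space N. (x, y) \<in> {z. fst z + snd z \<in> A}}) \<in> borel_measurable M"
    by (rule N.measurable_emeasure) measurable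
  then have meas: "(\<lambda>x. measure N {y. x + y \<in> A}) \<in> borel_measurable M"
    using sets_eq_imp_space_eq[OF N(2)] by (simp add: measure_def)
  show "integrable M (\<lambda>x. measure N {y. x + y \<in> A})"
    using meas by (intro M.integrable_const_bound[where B = "measure N (space N)"])
      (auto intro!: N.bounded_measure)
  have "emeasure (M \<star> N) A = (\<integral>\<^sup>+x. emeasure N {y. x + y \<in> A} \<partial>M)"
    using sets_eq_imp_space_eq[OF N(2)] sets_eq_imp_space_eq[OF M(2)]
    by (subst convolution_emeasure) (auto simp: add.commute)
  also have "\<dots> = (\<integral>\<^sup>+x. ennreal (measure N {y. x + y \<in> A}) \<partial>M)"
    by (simp add: N.emeasure_eq_measure)
  finally show "measure (M \<star> N) A = (\<integral>x. measure N {y. x + y \<in> A} \<partial>M)"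
    using meas by (simp add: measure_def[of "M \<star> N"] integral_eq_nn_integral)
qed

text \<open>
  The library convolution of finite measures is extended bilinearly through the Jordan
  decompositions; it is what imposes the sort \<open>ordered_euclidean_space\<close>, of which
  \<open>real ^ 'd\<close> is an instance. See \<open>sm_apply_times\<close> for the usual integral formula.
\<close>

instantiation signed_measure :: (ordered_euclidean_space) times
begin

definition times_signed_measure :: "'a signed_measure \<Rightarrow> 'a signed_measure \<Rightarrow> 'a signed_measure" where
  "V * W = sm_of_measure (pos_part V \<star> pos_part W) - sm_of_measure (pos_part V \<star> neg_part W)
         - sm_of_measure (neg_part V \<star> pos_part W) + sm_of_measure (neg_part V \<star> neg_part W)"

instance ..

end

lemma translate_borel [measurable, simp]:
  fixes x :: "'a::ordered_euclidean_space"
  assumes [measurable]: "A \<in> sets borel"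
  shows "{y. x + y \<in> A} \<in> sets borel"
  by measurable

lemma
  fixes V :: "'a::ordered_euclidean_space signed_measure"
  assumes M [simp]: "finite_measure M" "sets M = sets borel" and A [simp]: "A \<in> sets borel"
  shows integrable_sm: "integrable M (\<lambda>x. sm_apply V {y. x + y \<in> A})"
    and integral_sm: "(\<integral>x. sm_apply V {y. x + y \<in> A} \<partial>M) =
      measure (M \<star> pos_part V) A - measure (M \<star> neg_part V) A"
  by (simp_all add: jordan_decomposition measure_convolution)

lemma convolution_finite' [simp]:
  fixes M N :: "'a::ordered_euclidean_space measure"
  assumes "finite_measure M" "sets M = sets borel" "finite_measure N" "sets N = sets borel"
  shows "finite_measure (M \<star> N)"
  using assms by (intro convolution_finite)

lemma sm_apply_times:
  assumes "A \<in> sets borel"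
  shows "sm_apply (V * W) A =
    (\<integral>x. sm_apply W {y. x + y \<in> A} \<partial>pos_part V) - (\<integral>x. sm_apply W {y. x + y \<in> A} \<partial>neg_part V)"
  using assms by (simp add: times_signed_measure_def integral_sm)

lemma sm_times_commute: "V * W = W * (V :: 'a::ordered_euclidean_space signed_measure)"
  unfolding times_signed_measure_def
  by (simp add: convolution_commutative[of "pos_part W"] convolution_commutative[of "neg_part W"])

lemma sm_times_add: "U * (V + W) = U * V + U * (W :: 'a::ordered_euclidean_space signed_measure)"
  by (rule sm_eqI) (simp add: sm_apply_times integrable_sm)

lemma sm_times_scaleR: "U * (c *\<^sub>R V) = c *\<^sub>R (U * (V :: 'a::ordered_euclidean_space signed_measure))"
  by (rule sm_eqI) (simp add: sm_apply_times integrable_sm algebra_simps)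

lemma sm_times_minus: "U * (V - W) = U * V - U * (W :: 'a::ordered_euclidean_space signed_measure)"
  by (rule sm_eqI) (simp add: sm_apply_times integrable_sm)

lemma sm_times_minus_left: "(V - W) * U = V * U - W * (U :: 'a::ordered_euclidean_space signed_measure)"
  using sm_times_minus[of U V W] by (simp add: sm_times_commute)

lemma sm_of_measure_times:
  fixes M N :: "'a::ordered_euclidean_space measure"
  assumes M [simp]: "finite_measure M" "sets M = sets borel" and N [simp]: "finite_measure N" "sets N = sets borel"
  shows "sm_of_measure M * sm_of_measure N = sm_of_measure (M \<star> N)"
proof (rule sm_eqI)
  fix A :: "'a set" assume A [simp]: "A \<in> sets borel"
  have "measure (K \<star> neg_part (sm_of_measure L)) A = 0"
    if "finite_measure K" "sets K = sets borel" "finite_measure L" "sets L = sets borel" for K L :: "'a measure"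
    using that by (simp add: measure_convolution measure_neg_part_of_measure)
  moreover have "measure (neg_part (sm_of_measure M) \<star> N) A = measure (N \<star> neg_part (sm_of_measure M)) A"
    by (simp add: convolution_commutative)
  ultimately show "sm_apply (sm_of_measure M * sm_of_measure N) A = sm_apply (sm_of_measure (M \<star> N)) A"
    by (simp add: times_signed_measure_def pos_part_of_measure)
qed

lemma sm_times_assoc: "(U * V) * W = U * (V * (W :: 'a::ordered_euclidean_space signed_measure))"
proof -
  have *: "(sm_of_measure K * sm_of_measure L) * sm_of_measure M = sm_of_measure K * (sm_of_measure L * sm_of_measure M)"
    if "finite_measure K" "sets K = sets borel" "finite_measure L" "sets L = sets borel"
      "finite_measure M" "sets M = sets borel" for K L M :: "'a measure"
    using that by (simp add: sm_of_measure_times convolution_associative)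
  show ?thesis
    apply (subst (1 2) jordan_decomposition'[of U])
    apply (subst (1 2) jordan_decomposition'[of V])
    apply (subst (1 2) jordan_decomposition'[of W])
    apply (simp only: sm_times_minus sm_times_minus_left)
    apply (simp add: * )
    done
qed

lemma norm_sm_of_measure:
  assumes "finite_measure M" "sets M = sets borel"
  shows "norm (sm_of_measure M) = measure M UNIV"
  using assms by (simp add: norm_signed_measure_def pos_part_of_measure measure_neg_part_of_measure)

lemma measure_convolution_UNIV:
  fixes M N :: "'a::ordered_euclidean_space measure"
  assumes "finite_measure M" "sets M = sets borel" "finite_measure N" "sets N = sets borel"
  shows "measure (M \<star> N) UNIV = measure M UNIV * measure N UNIV"
  using assms sets_eq_imp_space_eq[OF assms(2)] by (simp add: measure_convolution)

lemma norm_dirac [simp]: "norm (dirac x) = 1"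
  by (simp add: dirac_def norm_sm_of_measure measure_return prob_space.finite_measure prob_space_return)

lemma dirac_times_dirac: "dirac x * dirac y = dirac (x + y :: 'a::ordered_euclidean_space)"
proof -
  have fm: "finite_measure (return borel z)" for z :: 'a
    by (simp add: prob_space.finite_measure prob_space_return)
  have "sm_apply (dirac x * dirac y) A = sm_apply (dirac (x + y)) A" if A [simp]: "A \<in> sets borel" for A
  proof -
    have "measure (return borel x \<star> return borel y) A = (\<integral>u. indicator {v. u + v \<in> A} y \<partial>return borel x)"
      by (simp add: measure_convolution fm measure_return)
    also have "\<dots> = indicator {v. x + v \<in> A} y"
    proof (rule integral_return)
      have "(\<lambda>a. indicator {v. a + v \<in> A} y) = (indicator {a. y + a \<in> A} :: 'a \<Rightarrow> real)"
        by (auto simp: indicator_def add.commute)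
      then show "(\<lambda>a. indicator {v. a + v \<in> A} y :: real) \<in> borel_measurable borel"
        by (simp add: borel_measurable_indicator)
    qed simp
    finally show ?thesis
      by (simp add: dirac_def sm_of_measure_times fm measure_return indicator_def)
  qed
  then show ?thesis by (rule sm_eqI)
qed

instantiation signed_measure :: (ordered_euclidean_space) "{comm_ring_1, real_normed_algebra_1}"
begin

definition one_signed_measure :: "'a signed_measure" where
  "1 = dirac 0"

instance
proof
  fix U V W :: "'a signed_measure" and c :: real
  show "U * V * W = U * (V * W)" by (rule sm_times_assoc)
  show "U * V = V * U" by (rule sm_times_commute)
  show "(U + V) * W = U * W + V * W"
    by (simp add: sm_times_commute[of _ W] sm_times_add)
  show "c *\<^sub>R U * V = c *\<^sub>R (U * V)"
    by (simp add: sm_times_commute[of _ V] sm_times_scaleR)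
  show "U * c *\<^sub>R V = c *\<^sub>R (U * V)"
    by (rule sm_times_scaleR)
  show "norm (1 :: 'a signed_measure) = 1"
    by (simp add: one_signed_measure_def)
  then show "(0 :: 'a signed_measure) \<noteq> 1"
    by (metis norm_zero zero_neq_one)
  have fm: "finite_measure (return borel (0::'a))"
    by (simp add: prob_space.finite_measure prob_space_return)
  have *: "dirac 0 * sm_of_measure M = sm_of_measure M" if "finite_measure M" "sets M = sets borel" for M :: "'a measure"
  proof (rule sm_eqI)
    fix A :: "'a set" assume A [simp]: "A \<in> sets borel"
    have "measure (return borel 0 \<star> M) A = measure (M \<star> return borel 0) A"
      using that fm by (simp add: convolution_commutative)
    also have "\<dots> = (\<integral>x. indicator A x \<partial>M)"
    proof -
      have "measure (return borel 0) {y. x + y \<in> A} = indicator A x" for x :: 'a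
        by (simp add: measure_return indicator_def)
      then show ?thesis
        using that fm by (simp add: measure_convolution)
    qed
    also have "\<dots> = measure M A"
      using that sets_eq_imp_space_eq[OF that(2)] by simp
    finally show "sm_apply (dirac 0 * sm_of_measure M) A = sm_apply (sm_of_measure M) A"
      using that fm by (simp add: dirac_def sm_of_measure_times)
  qed
  show "1 * V = V"
    unfolding one_signed_measure_def
    by (subst (1 2) jordan_decomposition'[of V]) (simp add: sm_times_minus * )
  then show "V * 1 = V"
    by (simp add: sm_times_commute)
  show "U * (V + W) = U * V + U * W"
    by (rule sm_times_add)
  have "norm (V * W) \<le> norm (sm_of_measure (pos_part V \<star> pos_part W)) + norm (sm_of_measure (pos_part V \<star> neg_part W))
      + norm (sm_of_measure (neg_part V \<star> pos_part W)) + norm (sm_of_measure (neg_part V \<star> neg_part W))"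
    unfolding times_signed_measure_def
    by (intro norm_triangle_le norm_triangle_le_diff add_mono order_refl)
  also have "\<dots> = norm V * norm W"
    by (simp add: norm_sm_of_measure measure_convolution_UNIV) (simp add: norm_signed_measure_def algebra_simps)
  finally show "norm (V * W) \<le> norm V * norm W" .
qed

end

lemma exp_signed_measure:
  fixes V :: "'a::ordered_euclidean_space signed_measure"
  shows "(\<lambda>m. V ^ m /\<^sub>R fact m) sums exp V" and "V ^ 0 = dirac 0"
  by (simp_all add: exp_converges one_signed_measure_def)

subsection \<open>The function \<open>g\<close>\<close>

text \<open>The summation index is shifted by \<open>2\<close>.\<close>

definition g :: "'a::{real_normed_field, banach} \<Rightarrow> 'a" where
  "g z = 2 * (\<Sum>m. of_nat (m + 1) / fact (m + 2) * z ^ m)"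

lemma g_0: "g 0 = 1"
  using powser_sums_zero[of "\<lambda>m. of_nat (m + 1) / fact (m + 2) :: 'a::{real_normed_field, banach}"]
  by (simp add: g_def sums_iff fact_numeral numeral_2_eq_2)

lemma g_closed_form:
  fixes z :: "'a::{real_normed_field, banach}"
  assumes "z \<noteq> 0"
  shows "g z = 2 * exp z / z ^ 2 * (exp (- z) - 1 + z)"
proof -
  have e: "(\<lambda>m. z ^ m / fact m) sums exp z"
    using exp_converges[of z] by (simp add: scaleR_conv_of_real divide_inverse mult.commute)
  have 1: "(\<lambda>m. z ^ (m + 1) / fact (m + 1)) sums (exp z - 1)"
    using sums_split_initial_segment[OF e, of 1] by simp
  have 2: "(\<lambda>m. z ^ (m + 2) / fact (m + 2)) sums (exp z - 1 - z)"
    using sums_split_initial_segment[OF e, of 2] by (simp add: numeral_2_eq_2 algebra_simps)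
  have "(\<lambda>m. z * (z ^ (m + 1) / fact (m + 1)) - z ^ (m + 2) / fact (m + 2)) sums (z * (exp z - 1) - (exp z - 1 - z))"
    by (intro sums_diff sums_mult 1 2)
  also have "z * (exp z - 1) - (exp z - 1 - z) = exp z * (exp (- z) - 1 + z)"
    by (simp add: algebra_simps flip: exp_add)
  also have "(\<lambda>m. z * (z ^ (m + 1) / fact (m + 1)) - z ^ (m + 2) / fact (m + 2)) =
      (\<lambda>m. z ^ 2 * (of_nat (m + 1) / fact (m + 2) * z ^ m))"
  proof
    fix m
    define k F :: 'a where "k = of_nat (m + 1)" and "F = fact (m + 1)"
    have f: "fact (m + 2) = (k + 1) * F"
      by (simp add: fact_reduce k_def F_def add.commute)
    have "k + 1 = of_nat (Suc (m + 1))" "F = fact (m + 1)"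
      by (simp_all add: k_def F_def)
    then have "F \<noteq> 0" "k + 1 \<noteq> 0"
      by (metis fact_nonzero, metis of_nat_neq_0)
    then show "z * (z ^ (m + 1) / fact (m + 1)) - z ^ (m + 2) / fact (m + 2) =
        z ^ 2 * (of_nat (m + 1) / fact (m + 2) * z ^ m)"
      unfolding f k_def[symmetric] F_def[symmetric]
      by (simp add: divide_simps power2_eq_square) (simp add: algebra_simps)
  qed
  finally have "(\<lambda>m. z ^ 2 * (of_nat (m + 1) / fact (m + 2) * z ^ m)) sums (exp z * (exp (- z) - 1 + z))" .
  from sums_divide[OF this, of "z ^ 2"] assms
  have "(\<lambda>m. of_nat (m + 1) / fact (m + 2) * z ^ m) sums (exp z * (exp (- z) - 1 + z) / z ^ 2)"
    by simp
  then show ?thesis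
    by (simp add: g_def sums_iff)
qed

end

theory Submission
  imports Defs
begin

text \<open>
  Kerstan's method. With \<open>z j = p j *\<^sub>R Q j\<close>, \<open>Q j = (\<Sum>r. q j r *\<^sub>R (dirac (axis r 1) - 1))\<close>, the
  factors of \<open>F\<close> are \<open>1 + z j = exp (z j) * (1 - (z j)\<^sup>2 * R j)\<close> with \<open>norm (R j) \<le> g (2 * p j) / 2\<close>,
  and \<open>G\<close> is the product of the \<open>exp (z j)\<close>. Expanding the product, one has to bound \<open>G\<close> times
  products of squares \<open>(Q j)\<^sup>2\<close>. Coordinates in which \<open>q j r / lam r\<close> is large are estimated
  trivially; for the others one uses that \<open>G\<close> times \<open>m\<close> linear forms
  \<open>\<Sum>r. c i r *\<^sub>R (dirac (axis r 1) - 1)\<close> has squared norm at most \<open>m! * (\<Prod>i. \<Sum>r. (c i r)\<^sup>2 / lam r)\<close>.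

  The latter is Bessel's inequality for the Charlier expansion of the sign function of a Hahn
  set. It is obtained from the factorisation, in the algebra of signed measures on the product
  space, of the law of \<open>(N, N)\<close>, where \<open>N\<close> has law \<open>G\<close>, as the law of two independent copies of \<open>N\<close>
  times \<open>exp \<Gamma>\<close>, with \<open>\<Gamma>\<close> a positive combination of tensor squares.
\<close>

subsection \<open>Push-forwards and tensor products\<close>

text \<open>The default 0 for a non-measurable \<open>f\<close> lets linearity and the norm bound
  hold without a measurability hypothesis, so \<open>pushforward f\<close> is a bounded linear map
  for every \<open>f\<close>.\<close>

lift_definition pushforward ::
  "('a::topological_space \<Rightarrow> 'b::topological_space) \<Rightarrow> 'a signed_measure \<Rightarrow> 'b signed_measure"
  is "\<lambda>f V A. if f \<in> borel_measurable borel \<and> A \<in> sets borel then V (f -` A) else 0"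
proof -
  fix f :: "'a \<Rightarrow> 'b" and V :: "'a set \<Rightarrow> real"
  assume V: "is_signed_measure V"
  show "is_signed_measure (\<lambda>A. if f \<in> borel_measurable borel \<and> A \<in> sets borel then V (f -` A) else 0)"
  proof (cases "f \<in> borel_measurable borel")
    case True
    show ?thesis
      unfolding is_signed_measure_def
    proof (intro conjI allI impI)
      fix A :: "nat \<Rightarrow> 'b set" assume A: "range A \<subseteq> sets borel" "disjoint_family A"
      have "(\<lambda>i. V (f -` A i)) sums V (\<Union>i. f -` A i)"
        using True A by (intro ism_sums[OF V])
          (auto simp: disjoint_family_on_def intro: measurable_sets_borel)
      moreover have "(\<Union>i. f -` A i) = f -` (\<Union>i. A i)" by blast
      ultimately show "(\<lambda>i. if f \<in> borel_measurable borel \<and> A i \<in> sets borel then V (f -` A i) else 0) sums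
          (if f \<in> borel_measurable borel \<and> (\<Union>i. A i) \<in> sets borel then V (f -` (\<Union>i. A i)) else 0)"
        using True A by (simp add: range_subsetD sets.countable_nat_UN)
    qed simp
  qed (simp add: is_signed_measure_def)
qed

lemma sm_apply_pushforward:
  assumes "f \<in> borel_measurable borel" "A \<in> sets borel"
  shows "sm_apply (pushforward f V) A = sm_apply V (f -` A)"
  using assms by (simp add: pushforward.rep_eq)

lemma pushforward_add: "pushforward f (V + W) = pushforward f V + pushforward f W"
  and pushforward_minus: "pushforward f (V - W) = pushforward f V - pushforward f W"
  and pushforward_scaleR: "pushforward f (c *\<^sub>R V) = c *\<^sub>R pushforward f V"
  by (rule sm_eqI; simp add: pushforward.rep_eq)+

text \<open>A Hahn set of the image and its complement pull back to disjoint Borel sets, to which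
  \<open>norm_sm_ge\<close> applies.\<close>

lemma norm_pushforward_le: "norm (pushforward f V) \<le> norm V"
proof (cases "f \<in> borel_measurable borel")
  case True
  let ?H = "hahn_set (pushforward f V)"
  have "norm (pushforward f V) = sm_apply V (f -` ?H) - sm_apply V (f -` (- ?H))"
    unfolding norm_sm_hahn using True by (simp add: sm_apply_pushforward)
  also have "\<dots> \<le> norm V"
    using norm_sm_ge[of "f -` ?H" "f -` (- ?H)" V] True
    by (fastforce intro: measurable_sets_borel)
  finally show ?thesis .
next
  case False
  then have "pushforward f V = 0"
    by (intro sm_eqI) (simp add: pushforward.rep_eq)
  then show ?thesis by simp
qed

lemma bounded_linear_pushforward: "bounded_linear (pushforward f)"
  by (rule bounded_linear_intro[where K = 1])
    (simp_all add: pushforward_add pushforward_scaleR norm_pushforward_le)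

lemma pushforward_dirac:
  assumes [measurable]: "f \<in> borel_measurable borel"
  shows "pushforward f (dirac x) = dirac (f x)"
proof (rule sm_eqI)
  fix A :: "'b set" assume [measurable]: "A \<in> sets borel"
  have "f -` A \<in> sets borel"
    using assms \<open>A \<in> sets borel\<close> by (rule measurable_sets_borel)
  then show "sm_apply (pushforward f (dirac x)) A = sm_apply (dirac (f x)) A"
    using assms by (simp add: sm_apply_pushforward sm_apply_dirac indicator_def)
qed

lemma pushforward_sm_of_measure:
  assumes f: "f \<in> borel_measurable borel" and M: "finite_measure M" "sets M = sets borel"
  shows "pushforward f (sm_of_measure M) = sm_of_measure (distr M borel f)"
proof (rule sm_eqI)
  fix A :: "'b set" assume A: "A \<in> sets borel"
  have f': "f \<in> measurable M borel"
    using f M by (simp cong: measurable_cong_sets)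
  then have "finite_measure (distr M borel f)"
    using M by (intro finite_measure.finite_measure_distr)
  then show "sm_apply (pushforward f (sm_of_measure M)) A = sm_apply (sm_of_measure (distr M borel f)) A"
    using f f' M A sets_eq_imp_space_eq[OF M(2)]
    by (simp add: sm_apply_pushforward measure_distr)
qed

lemma pushforward_times:
  fixes f :: "'a::ordered_euclidean_space \<Rightarrow> 'b::ordered_euclidean_space"
  assumes f: "f \<in> borel_measurable borel" and add: "\<And>x y. f (x + y) = f x + f y"
  shows "pushforward f (V * W) = pushforward f V * pushforward f W"
proof -
  \<comment> \<open>By the Jordan decompositions and bilinearity, finite positive measures suffice;
    for them the claim is a change of variables in the convolution integral.\<close>
  have *: "pushforward f (sm_of_measure M * sm_of_measure N) =
      pushforward f (sm_of_measure M) * pushforward f (sm_of_measure N)"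
    if M: "finite_measure M" "sets M = sets borel" and N: "finite_measure N" "sets N = sets borel"
    for M N :: "'a measure"
  proof -
    have fM: "f \<in> measurable M borel" and fN: "f \<in> measurable N borel"
      and fC: "f \<in> measurable (M \<star> N) borel"
      using f M N by (simp_all cong: measurable_cong_sets)
    have fin: "finite_measure (distr M borel f)" "finite_measure (distr N borel f)"
      "finite_measure (distr (M \<star> N) borel f)"
      using M N fM fN fC by (auto intro!: finite_measure.finite_measure_distr)
    have "measure (distr (M \<star> N) borel f) A = measure (distr M borel f \<star> distr N borel f) A"
      if A: "A \<in> sets borel" for A
    proof -
      have fA: "f -` A \<in> sets borel"
        using f A by (rule measurable_sets_borel)
      have "measure (distr (M \<star> N) borel f) A = measure (M \<star> N) (f -` A)"
        using fC A sets_eq_imp_space_eq[of "M \<star> N" borel] by (simp add: measure_distr)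
      also have "\<dots> = (\<integral>x. measure N {y. x + y \<in> f -` A} \<partial>M)"
        using M N fA by (rule measure_convolution)
      also have "\<dots> = (\<integral>x. measure (distr N borel f) {v. f x + v \<in> A} \<partial>M)"
        using fN A sets_eq_imp_space_eq[OF N(2)]
        by (simp add: measure_distr add vimage_def)
      also have "\<dots> = (\<integral>u. measure (distr N borel f) {v. u + v \<in> A} \<partial>distr M borel f)"
      proof (rule integral_distr[symmetric])
        \<comment> \<open>Measurability of the integrand is read off from its integrability, which
          \<open>measure_convolution\<close> supplies.\<close>
        have "integrable (distr M borel f) (\<lambda>u. measure (distr N borel f) {v. u + v \<in> A})"
          using fin A by (intro measure_convolution) auto
        then show "(\<lambda>u. measure (distr N borel f) {v. u + v \<in> A}) \<in> borel_measurable borel"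
          by (auto dest: borel_measurable_integrable)
      qed (rule fM)
      also have "\<dots> = measure (distr M borel f \<star> distr N borel f) A"
        using fin A by (intro measure_convolution(1)[symmetric]) auto
      finally show ?thesis .
    qed
    then show ?thesis
      using M N f fin
      by (intro sm_eqI) (simp add: sm_of_measure_times pushforward_sm_of_measure)
  qed
  show ?thesis
    apply (subst (1 2) jordan_decomposition'[of V])
    apply (subst (1 2) jordan_decomposition'[of W])
    apply (simp add: pushforward_minus left_diff_distrib right_diff_distrib * )
    done
qed

text \<open>A continuous unital algebra homomorphism may be applied to the exponential series term
  by term.\<close>

lemma bounded_linear_exp_commute:
  fixes f :: "'a::{real_normed_algebra_1, banach} \<Rightarrow> 'b::{real_normed_algebra_1, banach}"
  assumes f: "bounded_linear f" and one: "f 1 = 1" and times: "\<And>x y. f (x * y) = f x * f y"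
  shows "f (exp x) = exp (f x)"
proof -
  have pow: "f (x ^ m) = f x ^ m" for m
    by (induction m) (simp_all add: one times)
  have "(\<lambda>m. f (x ^ m /\<^sub>R fact m)) sums f (exp x)"
    by (rule bounded_linear.sums[OF f exp_converges])
  then have "(\<lambda>m. f x ^ m /\<^sub>R fact m) sums f (exp x)"
    using f by (simp add: pow linear_cmul bounded_linear.linear)
  then show ?thesis
    using exp_converges sums_unique2 by blast
qed

lemma pushforward_exp:
  fixes f :: "'a::ordered_euclidean_space \<Rightarrow> 'b::ordered_euclidean_space"
  assumes f: "f \<in> borel_measurable borel" and add: "\<And>x y. f (x + y) = f x + f y"
  shows "pushforward f (exp V) = exp (pushforward f V)"
proof (rule bounded_linear_exp_commute)
  have "f 0 = 0" using add[of 0 0] by simp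
  then show "pushforward f 1 = 1"
    using f by (simp add: one_signed_measure_def pushforward_dirac)
qed (simp_all add: bounded_linear_pushforward pushforward_times f add)

text \<open>Convolving the images under the two coordinate embeddings yields the product measure of
  \<open>V\<close> and \<open>W\<close>. Tensor products are thus ordinary products in the
  commutative Banach algebra of signed measures on \<open>'a \<times> 'a\<close>, where
  \<open>exp\<close> is available.\<close>

lemma sm_apply_rectangle:
  fixes V W :: "'a::ordered_euclidean_space signed_measure"
  assumes A: "A \<in> sets borel" and B: "B \<in> sets borel"
  shows "sm_apply (pushforward (\<lambda>x. (x, 0 :: 'a)) V * pushforward (\<lambda>x. (0 :: 'a, x)) W) (A \<times> B) =
    sm_apply V A * sm_apply W B"
proof -
  let ?l = "\<lambda>x. (x, 0 :: 'a)" and ?r = "\<lambda>x. (0 :: 'a, x)"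
  have l: "?l \<in> borel_measurable borel" and r: "?r \<in> borel_measurable borel"
    by (intro borel_measurable_continuous_onI continuous_intros)+
  have AB: "A \<times> B \<in> sets borel"
    using A B by (rule borel_Times)
  have *: "sm_apply (pushforward ?l (sm_of_measure M) * pushforward ?r (sm_of_measure N)) (A \<times> B) =
      measure M A * measure N B"
    if M: "finite_measure M" "sets M = sets borel" and N: "finite_measure N" "sets N = sets borel"
    for M N :: "'a measure"
  proof -
    interpret M: finite_measure M by fact
    have lM: "?l \<in> measurable M borel" and rN: "?r \<in> measurable N borel"
      using l r M N by (simp_all cong: measurable_cong_sets)
    have fin: "finite_measure (distr M borel ?l)" "finite_measure (distr N borel ?r)"
      using M N lM rN by (auto intro!: finite_measure.finite_measure_distr)
    have "sm_apply (pushforward ?l (sm_of_measure M) * pushforward ?r (sm_of_measure N)) (A \<times> B) =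
        measure (distr M borel ?l \<star> distr N borel ?r) (A \<times> B)"
      using M N l r fin by (simp add: sm_of_measure_times pushforward_sm_of_measure)
    also have "\<dots> = (\<integral>u. measure (distr N borel ?r) {v. u + v \<in> A \<times> B} \<partial>distr M borel ?l)"
      using fin AB by (intro measure_convolution) auto
    also have "\<dots> = (\<integral>x. measure (distr N borel ?r) {v. ?l x + v \<in> A \<times> B} \<partial>M)"
    proof (rule integral_distr)
      have "integrable (distr M borel ?l) (\<lambda>u. measure (distr N borel ?r) {v. u + v \<in> A \<times> B})"
        using fin AB by (intro measure_convolution) auto
      then show "(\<lambda>u. measure (distr N borel ?r) {v. u + v \<in> A \<times> B}) \<in> borel_measurable borel"
        by (auto dest: borel_measurable_integrable)
    qed (rule lM)
    also have "\<dots> = (\<integral>x. indicator A x * measure N B \<partial>M)"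
    proof (rule Bochner_Integration.integral_cong[OF refl])
      fix x
      have "measure (distr N borel ?r) {v. ?l x + v \<in> A \<times> B} = measure N (?r -` {v. ?l x + v \<in> A \<times> B})"
        using rN AB sets_eq_imp_space_eq[OF N(2)] by (simp add: measure_distr)
      also have "?r -` {v. ?l x + v \<in> A \<times> B} = (if x \<in> A then B else {})"
        by (auto simp: vimage_def)
      finally show "measure (distr N borel ?r) {v. ?l x + v \<in> A \<times> B} = indicator A x * measure N B"
        by simp
    qed
    also have "\<dots> = measure M A * measure N B"
      using A M sets_eq_imp_space_eq[OF M(2)] by simp
    finally show ?thesis .
  qed
  show ?thesis
    apply (subst (1) jordan_decomposition'[of V])
    apply (subst (1) jordan_decomposition'[of W])
    apply (simp add: pushforward_minus jordan_decomposition[of _ V] jordan_decomposition[of _ W]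
        A B left_diff_distrib right_diff_distrib * )
    done
qed

subsection \<open>Bessel's inequality for Poisson convolutions\<close>

text \<open>The integral with respect to \<open>V\<close> of the sign function that is 1 on
  \<open>P\<close> and -1 on its complement.\<close>

definition pairing :: "'a::topological_space set \<Rightarrow> 'a signed_measure \<Rightarrow> real" where
  "pairing P V = sm_apply V P - sm_apply V (- P)"

lemma bounded_linear_pairing: "bounded_linear (pairing P)"
proof (rule bounded_linear_intro[where K = 2])
  fix V :: "'a signed_measure"
  show "norm (pairing P V) \<le> norm V * 2"
    using norm_sm_ge1[of V P] norm_sm_ge1[of V "- P"] by (simp add: pairing_def)
qed (simp_all add: pairing_def algebra_simps)

lemma pairing_le_norm: "P \<in> sets borel \<Longrightarrow> pairing P V \<le> norm V"
  using norm_sm_ge[of P "- P" V] by (auto simp: pairing_def)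

lemma pairing_hahn_set: "pairing (hahn_set V) V = norm V"
  by (simp add: pairing_def norm_sm_hahn)

text \<open>With f the sign function of \<open>P\<close>, the set on the left is where f(x) f(y) =
  1, so the pairing integrates f(x) f(y) against the product measure.\<close>

lemma pairing_rectangles:
  fixes V W :: "'a::ordered_euclidean_space signed_measure"
  assumes P: "P \<in> sets borel"
  shows "pairing (P \<times> P \<union> (- P) \<times> (- P))
      (pushforward (\<lambda>x. (x, 0 :: 'a)) V * pushforward (\<lambda>x. (0 :: 'a, x)) W) = pairing P V * pairing P W"
proof -
  have *: "- (P \<times> P \<union> (- P) \<times> (- P)) = P \<times> (- P) \<union> (- P) \<times> P"
    by auto
  have nP: "- P \<in> sets borel"
    using P by auto
  note rect = borel_Times[OF P P] borel_Times[OF P nP] borel_Times[OF nP P] borel_Times[OF nP nP]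
  show ?thesis
    unfolding pairing_def *
    using P nP rect
    by (subst (1 2) ism_Un[OF is_signed_measure_sm_apply])
      (auto simp: sm_apply_rectangle left_diff_distrib right_diff_distrib)
qed

text \<open>This is a compound Poisson law: the negative multiples of the identity split off as the
  scalar \<open>exp (- ?c)\<close>, which compensates \<open>exp (norm ?A)\<close>.\<close>

lemma norm_exp_dirac_le_1:
  fixes x :: "'r \<Rightarrow> 'a::ordered_euclidean_space"
  assumes "finite I" "\<And>r. r \<in> I \<Longrightarrow> 0 \<le> c r"
  shows "norm (exp (\<Sum>r\<in>I. c r *\<^sub>R (dirac (x r) - 1))) \<le> 1"
proof -
  let ?A = "\<Sum>r\<in>I. c r *\<^sub>R dirac (x r)" and ?c = "\<Sum>r\<in>I. c r"
  have "(\<Sum>r\<in>I. c r *\<^sub>R (dirac (x r) - 1)) = ?A + (- ?c) *\<^sub>R 1"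
    by (simp add: scaleR_diff_right sum_subtractf scaleR_sum_left)
  then have "exp (\<Sum>r\<in>I. c r *\<^sub>R (dirac (x r) - 1)) = exp ?A * of_real (exp (- ?c))"
    by (simp add: exp_add_commuting exp_of_real flip: of_real_def of_real_minus)
  also have "norm \<dots> \<le> exp (norm ?A) * exp (- ?c)"
    by (intro order_trans[OF norm_mult_ineq] mult_mono norm_exp) auto
  also have "norm ?A \<le> ?c"
    using assms by (intro sum_norm_le) simp
  finally show ?thesis
    by (simp add: exp_minus)
qed

lemma weighted_Cauchy_Schwarz:
  fixes l :: "'r \<Rightarrow> real"
  assumes "\<And>r. r \<in> I \<Longrightarrow> 0 < l r"
  shows "(\<Sum>r\<in>I. c r * y r)\<^sup>2 \<le> (\<Sum>r\<in>I. (c r)\<^sup>2 / l r) * (\<Sum>r\<in>I. l r * (y r)\<^sup>2)"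
proof -
  have "(\<Sum>r\<in>I. c r * y r) = (\<Sum>r\<in>I. (c r / sqrt (l r)) * (sqrt (l r) * y r))"
    using assms by (intro sum.cong) fastforce+
  also have "\<dots>\<^sup>2 \<le> (\<Sum>r\<in>I. (c r / sqrt (l r))\<^sup>2) * (\<Sum>r\<in>I. (sqrt (l r) * y r)\<^sup>2)"
    by (rule Cauchy_Schwarz_ineq_sum)
  also have "\<dots> = (\<Sum>r\<in>I. (c r)\<^sup>2 / l r) * (\<Sum>r\<in>I. l r * (y r)\<^sup>2)"
    using assms by (intro arg_cong2[where f = "(*)"] sum.cong)
      (auto simp: power_divide power_mult_distrib less_imp_le)
  finally show ?thesis .
qed

text \<open>Testing against the sign function of the Hahn set of \<open>V\<close> turns the norm
  into a pairing. Cauchy-Schwarz, once per linear form, bounds its square by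
  \<open>N (card I) G\<close> times the product on the right, and \<open>N m G / fact m\<close> is
  one term of a nonnegative series with sum at most 1.\<close>

lemma norm_Poisson_times_differences:
  fixes x :: "'r::finite \<Rightarrow> 'a::ordered_euclidean_space" and c :: "'i \<Rightarrow> 'r \<Rightarrow> real"
  assumes l: "\<And>r. 0 < l r" and I: "finite I"
  shows "(norm (exp (\<Sum>r\<in>UNIV. l r *\<^sub>R (dirac (x r) - 1)) *
      (\<Prod>i\<in>I. \<Sum>r\<in>UNIV. c i r *\<^sub>R (dirac (x r) - 1))))\<^sup>2
    \<le> fact (card I) * (\<Prod>i\<in>I. \<Sum>r\<in>UNIV. (c i r)\<^sup>2 / l r)"
proof -
  define D where "D r = dirac (x r) - 1" for r
  define G where "G = exp (\<Sum>r\<in>UNIV. l r *\<^sub>R D r)"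
  define V where "V = G * (\<Prod>i\<in>I. \<Sum>r\<in>UNIV. c i r *\<^sub>R D r)"
  define P where "P = hahn_set V"
  define E where "E = P \<times> P \<union> (- P) \<times> (- P)"
  define il ir :: "'a signed_measure \<Rightarrow> ('a \<times> 'a) signed_measure"
    where "il = pushforward (\<lambda>x. (x, 0))" and "ir = pushforward (\<lambda>x. (0, x))"
  define \<Gamma> where "\<Gamma> = (\<Sum>r\<in>UNIV. l r *\<^sub>R (il (D r) * ir (D r)))"
  \<comment> \<open>\<open>N m U\<close> is a sum of squares; \<open>N m G / fact m\<close> is the squared norm of the \<open>m\<close>-th Charlier component.\<close>
  define N where "N m U = pairing E (il U * ir U * \<Gamma> ^ m)" for m U
  have P: "P \<in> sets borel"
    by (simp add: P_def)
  have E: "E \<in> sets borel"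
    using P by (auto simp: E_def intro!: borel_Times)
  have ml: "(\<lambda>x. (x, 0 :: 'a)) \<in> borel_measurable borel" and mr: "(\<lambda>x. (0 :: 'a, x)) \<in> borel_measurable borel"
    by (intro borel_measurable_continuous_onI continuous_intros)+
  have bl: "bounded_linear il" "bounded_linear ir"
    by (simp_all add: il_def ir_def bounded_linear_pushforward)
  note lin = bl[THEN bounded_linear.linear]
  have times: "il (U * W) = il U * il W" "ir (U * W) = ir U * ir W" for U W
    by (simp_all add: il_def ir_def pushforward_times ml mr)
  have iexp: "il (exp U) = exp (il U)" "ir (exp U) = exp (ir U)" for U
    by (simp_all add: il_def ir_def pushforward_exp ml mr)
  have iD: "il (D r) = dirac (x r, 0) - 1" "ir (D r) = dirac (0, x r) - 1" for r
    by (simp_all add: il_def ir_def D_def pushforward_minus pushforward_dirac ml mr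
        one_signed_measure_def zero_prod_def)
  note linp = bounded_linear_pairing[THEN bounded_linear.linear]
  have N0: "N 0 U = (pairing P U)\<^sup>2" for U
    using pairing_rectangles[OF P, of U U]
    by (simp add: N_def E_def il_def ir_def power2_eq_square)
  \<comment> \<open>One factor \<open>\<Gamma>\<close> is distributed over the two tensor slots.
    Iterated, this writes \<open>N m U\<close> as a sum of squares with positive weights, since
    \<open>N 0\<close> is a square.\<close>
  have NSuc: "N (Suc m) U = (\<Sum>r\<in>UNIV. l r * N m (U * D r))" for m U
  proof -
    have "il U * ir U * \<Gamma> ^ Suc m =
        (\<Sum>r\<in>UNIV. l r *\<^sub>R (il (U * D r) * ir (U * D r) * \<Gamma> ^ m))"
      by (simp add: \<Gamma>_def sum_distrib_left sum_distrib_right times algebra_simps)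
    then show ?thesis
      by (simp add: N_def linear_sum[OF linp] linear_cmul[OF linp])
  qed
  have Nnn: "0 \<le> N m U" for m U
  proof (induction m arbitrary: U)
    case (Suc m)
    then show ?case using l by (auto simp: NSuc less_imp_le intro!: sum_nonneg)
  qed (simp add: N0)
  have Nsum: "(\<lambda>m. N m G / fact m) sums pairing E (il G * ir G * exp \<Gamma>)"
  proof -
    have "(\<lambda>m. pairing E (il G * ir G * (\<Gamma> ^ m /\<^sub>R fact m))) sums pairing E (il G * ir G * exp \<Gamma>)"
      by (intro bounded_linear.sums[OF bounded_linear_pairing] sums_mult exp_converges)
    then show ?thesis
      by (simp add: N_def linear_cmul[OF linp] divide_inverse mult.commute)
  qed
  \<comment> \<open>Expansion of \<open>(1 + il (D r)) * (1 + ir (D r)) - 1\<close>; weighted by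
    \<open>l r\<close> and summed, the cross terms give \<open>\<Gamma>\<close>.\<close>
  have "dirac (x r, x r) - 1 = il (D r) + ir (D r) + il (D r) * ir (D r)" for r
  proof -
    have "dirac (x r, 0) * dirac (0, x r) = dirac (x r, x r)"
      by (simp add: dirac_times_dirac)
    then show ?thesis by (simp add: iD algebra_simps)
  qed
  then have "(\<Sum>r\<in>UNIV. l r *\<^sub>R (dirac (x r, x r) - 1)) =
      il (\<Sum>r\<in>UNIV. l r *\<^sub>R D r) + ir (\<Sum>r\<in>UNIV. l r *\<^sub>R D r) + \<Gamma>"
    by (simp add: \<Gamma>_def linear_sum[OF lin(1)] linear_sum[OF lin(2)]
        linear_cmul[OF lin(1)] linear_cmul[OF lin(2)] scaleR_add_right sum.distrib)
  then have "il G * ir G * exp \<Gamma> = exp (\<Sum>r\<in>UNIV. l r *\<^sub>R (dirac (x r, x r) - 1))"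
    by (simp add: G_def iexp exp_add_commuting mult.commute)
  then have Nle: "pairing E (il G * ir G * exp \<Gamma>) \<le> 1"
    using l by (simp add: less_imp_le order_trans[OF pairing_le_norm[OF E]] norm_exp_dirac_le_1)
  have NG: "N m G \<le> fact m" for m
  proof -
    have "(\<Sum>k\<in>{m}. N k G / fact k) \<le> (\<Sum>k. N k G / fact k)"
      using Nsum Nnn by (intro sum_le_suminf) (auto dest: sums_summable)
    with Nsum have "N m G / fact m \<le> pairing E (il G * ir G * exp \<Gamma>)"
      by (simp add: sums_iff)
    with Nle have "N m G / fact m \<le> 1" by linarith
    then show ?thesis by simp
  qed
  \<comment> \<open>\<open>U\<close> stays arbitrary in the induction because each removed linear
    form leaves a factor \<open>D r\<close> attached to it; Cauchy-Schwarz with weights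
    \<open>l r\<close> then matches the recursion \<open>NSuc\<close>.\<close>
  have "(pairing P (U * (\<Prod>i\<in>I. \<Sum>r\<in>UNIV. c i r *\<^sub>R D r)))\<^sup>2 \<le>
      N (card I) U * (\<Prod>i\<in>I. \<Sum>r\<in>UNIV. (c i r)\<^sup>2 / l r)" for U
    using I
  proof (induction I arbitrary: U)
    case (insert j J)
    let ?X = "\<Prod>i\<in>J. \<Sum>r\<in>UNIV. c i r *\<^sub>R D r" and ?S = "\<Prod>i\<in>J. \<Sum>r\<in>UNIV. (c i r)\<^sup>2 / l r"
    let ?s = "\<Sum>r\<in>UNIV. (c j r)\<^sup>2 / l r"
    have s: "0 \<le> ?s" using l by (auto simp: less_imp_le intro!: sum_nonneg)
    have "U * (\<Prod>i\<in>insert j J. \<Sum>r\<in>UNIV. c i r *\<^sub>R D r) = (\<Sum>r\<in>UNIV. c j r *\<^sub>R (U * D r * ?X))"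
      using insert by (simp add: sum_distrib_left sum_distrib_right mult_ac)
    then have "(pairing P (U * (\<Prod>i\<in>insert j J. \<Sum>r\<in>UNIV. c i r *\<^sub>R D r)))\<^sup>2 =
        (\<Sum>r\<in>UNIV. c j r * pairing P (U * D r * ?X))\<^sup>2"
      by (simp add: linear_sum[OF linp] linear_cmul[OF linp])
    also have "\<dots> \<le> ?s * (\<Sum>r\<in>UNIV. l r * (pairing P (U * D r * ?X))\<^sup>2)"
      by (rule weighted_Cauchy_Schwarz) (rule l)
    also have "\<dots> \<le> ?s * (\<Sum>r\<in>UNIV. l r * (N (card J) (U * D r) * ?S))"
      using s l by (intro mult_left_mono sum_mono insert.IH) (auto simp: less_imp_le)
    also have "(\<Sum>r\<in>UNIV. l r * (N (card J) (U * D r) * ?S)) = N (Suc (card J)) U * ?S"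
      by (simp add: NSuc sum_distrib_right mult.assoc)
    also have "?s * (N (Suc (card J)) U * ?S) =
        N (card (insert j J)) U * (\<Prod>i\<in>insert j J. \<Sum>r\<in>UNIV. (c i r)\<^sup>2 / l r)"
      using insert by (simp add: mult_ac)
    finally show ?case .
  qed (simp add: N0)
  from this[of G] have "(norm V)\<^sup>2 \<le> N (card I) G * (\<Prod>i\<in>I. \<Sum>r\<in>UNIV. (c i r)\<^sup>2 / l r)"
    by (simp add: P_def V_def pairing_hahn_set flip: V_def)
  also have "\<dots> \<le> fact (card I) * (\<Prod>i\<in>I. \<Sum>r\<in>UNIV. (c i r)\<^sup>2 / l r)"
    using NG l by (intro mult_right_mono prod_nonneg sum_nonneg) (auto simp: less_imp_le)
  finally show ?thesis
    by (simp add: V_def G_def D_def)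
qed

subsection \<open>Kerstan's expansion\<close>

lemma summable_g: "summable (\<lambda>m. real (m + 1) / fact (m + 2) * x ^ m)"
proof (rule summable_comparison_test')
  show "summable (\<lambda>m. inverse (fact m) * \<bar>x\<bar> ^ m)"
    by (rule summable_exp)
  fix m :: nat
  have "fact (m + 2) = real (m + 2) * (real (m + 1) * fact m)"
    by (simp add: fact_reduce)
  then have "real (m + 1) / fact (m + 2) = 1 / (real (m + 2) * fact m)"
    by (simp only: mult.left_commute) simp
  also have "\<dots> = 1 / real (m + 2) * inverse (fact m)"
    by (simp add: divide_inverse)
  also have "\<dots> \<le> inverse (fact m)"
    by (intro mult_left_le_one_le) auto
  finally have "real (m + 1) / fact (m + 2) * \<bar>x\<bar> ^ m \<le> inverse (fact m) * \<bar>x\<bar> ^ m"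
    by (rule mult_right_mono) simp
  then show "norm (real (m + 1) / fact (m + 2) * x ^ m) \<le> inverse (fact m) * \<bar>x\<bar> ^ m"
    by (simp only: real_norm_def abs_mult abs_divide power_abs abs_of_nat
        abs_of_nonneg[OF fact_ge_zero])
qed

lemma g_mono:
  fixes x y :: real
  assumes "0 \<le> x" "x \<le> y"
  shows "g x \<le> g y"
  unfolding g_def
  using assms by (intro mult_left_mono suminf_le summable_g power_mono) auto

lemma g_ge_1:
  fixes x :: real
  assumes "0 \<le> x"
  shows "1 \<le> g x"
  using g_mono[of 0 x] assms by (simp add: g_0)

text \<open>Apart from its constant term 1 the series of \<open>g\<close> has positive powers and
  nonnegative coefficients, and \<open>t ^ (m + 1) \<le> t\<close>; this is convexity along the
  chord from 0 to \<open>x\<close>.\<close>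

lemma g_le_chord:
  fixes t x :: real
  assumes "0 \<le> t" "t \<le> 1" "0 \<le> x"
  shows "g (t * x) \<le> 1 + t * (g x - 1)"
proof -
  let ?c = "\<lambda>m. real (m + 1) / fact (m + 2)"
  have c0: "(\<Sum>m<1. ?c m * y ^ m) = 1 / 2" for y
    by (simp add: numeral_2_eq_2)
  have tail: "summable (\<lambda>m. ?c (m + 1) * y ^ (m + 1))" for y
    using summable_g[of y] by (subst summable_iff_shift)
  have g: "g y = 1 + 2 * (\<Sum>m. ?c (m + 1) * y ^ (m + 1))" for y
    unfolding g_def using suminf_split_initial_segment[OF summable_g[of y], of 1] c0[of y] by simp
  have "(\<Sum>m. ?c (m + 1) * (t * x) ^ (m + 1)) \<le> (\<Sum>m. t * (?c (m + 1) * x ^ (m + 1)))"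
  proof (rule suminf_le[OF _ tail])
    show "summable (\<lambda>m. t * (?c (m + 1) * x ^ (m + 1)))"
      by (intro summable_mult tail)
    fix m
    have "t ^ m \<le> 1" using assms by (simp add: power_le_one)
    then have "t ^ (m + 1) \<le> t" using assms mult_left_mono[of "t ^ m" 1 t] by simp
    then have "t ^ (m + 1) * (?c (m + 1) * x ^ (m + 1)) \<le> t * (?c (m + 1) * x ^ (m + 1))"
      using assms by (intro mult_right_mono) auto
    then show "?c (m + 1) * (t * x) ^ (m + 1) \<le> t * (?c (m + 1) * x ^ (m + 1))"
      by (simp add: power_mult_distrib mult_ac)
  qed
  also have "\<dots> = t * (\<Sum>m. ?c (m + 1) * x ^ (m + 1))"
    by (rule suminf_mult[OF tail])
  finally show ?thesis
    unfolding g[of x] g[of "t * x"] by (simp add: algebra_simps)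
qed

text \<open>The series of the remainder \<open>R\<close> in powers of \<open>- z\<close> has the
  coefficients of \<open>g / 2\<close>. These are nonnegative, so the norm is majorized by
  evaluating the same series at \<open>norm z\<close>.\<close>

lemma Kerstan_remainder:
  fixes z :: "'a::{real_normed_algebra_1, banach}"
  shows "\<exists>R. exp (- z) * (1 + z) = 1 - z\<^sup>2 * R \<and> norm R \<le> g (norm z) / 2"
proof -
  define w where "w = - z"
  define c where "c m = real (m + 1) / fact (m + 2)" for m
  define R where "R = (\<Sum>m. c m *\<^sub>R w ^ m)"
  have nrm: "norm (c m *\<^sub>R w ^ m) \<le> c m * norm w ^ m" for m
    using mult_left_mono[OF norm_power_ineq[of w m], of "c m"] by (simp add: c_def)
  have sm: "summable (\<lambda>m. c m * norm w ^ m)"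
    unfolding c_def by (rule summable_g)
  have sR: "summable (\<lambda>m. norm (c m *\<^sub>R w ^ m))"
    by (rule summable_comparison_test'[OF sm]) (use nrm in auto)
  have "norm R \<le> (\<Sum>m. norm (c m *\<^sub>R w ^ m))"
    unfolding R_def by (rule summable_norm[OF sR])
  also have "\<dots> \<le> (\<Sum>m. c m * norm w ^ m)"
    by (rule suminf_le[OF nrm sR sm])
  also have "\<dots> = g (norm z) / 2"
    by (simp add: g_def c_def w_def)
  finally have nR: "norm R \<le> g (norm z) / 2" .
  have e1: "(\<lambda>m. w ^ (m + 1) /\<^sub>R fact (m + 1)) sums (exp w - 1)"
    using sums_split_initial_segment[OF exp_converges[of w], of 1] by simp
  have e2: "(\<lambda>m. w ^ (m + 2) /\<^sub>R fact (m + 2)) sums (exp w - 1 - w)"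
    using sums_split_initial_segment[OF exp_converges[of w], of 2] by (simp add: numeral_2_eq_2 algebra_simps)
  have "(\<lambda>m. w * (w ^ (m + 1) /\<^sub>R fact (m + 1)) - w ^ (m + 2) /\<^sub>R fact (m + 2)) sums
      (w * (exp w - 1) - (exp w - 1 - w))"
    by (intro sums_diff sums_mult e1 e2)
  also have "(\<lambda>m. w * (w ^ (m + 1) /\<^sub>R fact (m + 1)) - w ^ (m + 2) /\<^sub>R fact (m + 2)) =
      (\<lambda>m. w\<^sup>2 * (c m *\<^sub>R w ^ m))"
  proof
    fix m
    \<comment> \<open>With \<open>F = fact (m + 1)\<close> and \<open>a = m + 2\<close> this
      identifies the difference of the two exponential coefficients as \<open>c m\<close>.\<close>
    have *: "inverse F - inverse (a * F) = (a - 1) / (a * F)" if "F \<noteq> 0" "a \<noteq> 0" for F a :: real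
      using that by (simp add: field_simps)
    have "fact (m + 2) = real (m + 2) * fact (m + 1)"
      by simp
    then have "inverse (fact (m + 1)) - inverse (fact (m + 2)) = c m"
      using *[of "fact (m + 1)" "real (m + 2)"] by (simp add: c_def del: fact_Suc)
    then show "w * (w ^ (m + 1) /\<^sub>R fact (m + 1)) - w ^ (m + 2) /\<^sub>R fact (m + 2) = w\<^sup>2 * (c m *\<^sub>R w ^ m)"
      by (simp add: power2_eq_square mult.assoc flip: scaleR_left_diff_distrib)
  qed
  finally have "(\<lambda>m. w\<^sup>2 * (c m *\<^sub>R w ^ m)) sums (w * (exp w - 1) - (exp w - 1 - w))" .
  moreover have "(\<lambda>m. w\<^sup>2 * (c m *\<^sub>R w ^ m)) sums (w\<^sup>2 * R)"
    unfolding R_def by (intro sums_mult summable_sums summable_norm_cancel[OF sR])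
  ultimately have "w * (exp w - 1) - (exp w - 1 - w) = w\<^sup>2 * R"
    by (rule sums_unique2)
  moreover have "w * exp w = exp w * w"
    by (rule exp_times_arg_commute[symmetric])
  ultimately have "exp (- z) * (1 + z) = 1 - z\<^sup>2 * R"
    by (simp add: w_def algebra_simps)
  with nR show ?thesis by blast
qed

section \<open>Expansion of products over subsets of indices\<close>

lemma sum_Pow_insert:
  assumes "finite A" "x \<notin> A"
  shows "(\<Sum>T\<in>Pow (insert x A). f T) = (\<Sum>T\<in>Pow A. f T) + (\<Sum>T\<in>Pow A. f (insert x T))"
proof -
  have "inj_on (insert x) (Pow A)"
    using assms(2) by (auto simp: inj_on_def)
  then show ?thesis
    using assms unfolding Pow_insert
    by (subst sum.union_disjoint) (auto simp: sum.reindex)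
qed

text \<open>The offset \<open>m\<close> makes the induction work; the lemma is applied with \<open>m = 0\<close>.\<close>

lemma sum_Pow_fact_prod_le:
  fixes u :: "'i \<Rightarrow> real"
  assumes "finite A" "\<And>i. i \<in> A \<Longrightarrow> 0 \<le> u i" "sum u A < 1"
  shows "(\<Sum>T\<in>Pow A. fact (card T + m) * prod u T) \<le> fact m / (1 - sum u A) ^ (m + 1)"
  using assms
proof (induction A arbitrary: m)
  case (insert x A)
  define s where "s = 1 - sum u A"
  have u: "0 \<le> u x" "u x < s"
    using insert by (auto simp: s_def)
  then have s: "0 < s" by simp
  have IH: "(\<Sum>T\<in>Pow A. fact (card T + m) * prod u T) \<le> fact m / s ^ (m + 1)" for m
    unfolding s_def using insert.prems s by (intro insert.IH) (auto simp: s_def)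
  have T: "card (insert x T) = Suc (card T)" "prod u (insert x T) = u x * prod u T" if "T \<in> Pow A" for T
  proof -
    have "finite T" "x \<notin> T"
      using that insert.hyps finite_subset[of T A] by auto
    then show "card (insert x T) = Suc (card T)" "prod u (insert x T) = u x * prod u T"
      by simp_all
  qed
  \<comment> \<open>Subsets containing \<open>x\<close> have one element more, so they reproduce the
    sum over \<open>Pow A\<close> with offset \<open>Suc m\<close>.\<close>
  have "(\<Sum>T\<in>Pow (insert x A). fact (card T + m) * prod u T) =
      (\<Sum>T\<in>Pow A. fact (card T + m) * prod u T) +
      u x * (\<Sum>T\<in>Pow A. fact (card T + Suc m) * prod u T)"
    using insert.hyps T by (simp add: sum_Pow_insert sum_distrib_left mult_ac del: fact_Suc)
  also have "\<dots> \<le> fact m / s ^ (m + 1) + u x * (fact (Suc m) / s ^ (Suc m + 1))"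
    using u by (intro add_mono mult_left_mono IH)
  also have "\<dots> = fact m / s ^ (m + 1) * (1 + real (m + 1) * (u x / s))"
    using s by (simp add: field_simps)
  \<comment> \<open>Bernoulli's inequality followed by 1 + y \<le> 1 / (1 - y) for y =
    \<open>u x / s\<close>; the last factor turns \<open>s\<close> into
    \<open>s - u x\<close>.\<close>
  also have "\<dots> \<le> fact m / s ^ (m + 1) * (1 / (1 - u x / s)) ^ (m + 1)"
  proof (rule mult_left_mono)
    have "(1 + u x / s) \<le> 1 / (1 - u x / s)"
      using u s by (simp add: field_simps)
    then have "(1 + u x / s) ^ (m + 1) \<le> (1 / (1 - u x / s)) ^ (m + 1)"
      using u s by (intro power_mono) auto
    moreover have "1 + real (m + 1) * (u x / s) \<le> (1 + u x / s) ^ (m + 1)"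
      using u s by (intro Bernoulli_inequality) (simp add: order_trans[of "-1" 0])
    ultimately show "1 + real (m + 1) * (u x / s) \<le> (1 / (1 - u x / s)) ^ (m + 1)"
      by linarith
  qed (use s in simp)
  also have "\<dots> = fact m / (s * (1 - u x / s)) ^ (m + 1)"
    by (simp add: power_mult_distrib power_divide del: power_Suc)
  also have "s * (1 - u x / s) = 1 - sum u (insert x A)"
    using s insert.hyps by (simp add: s_def field_simps)
  finally show ?case .
qed simp

lemma norm_prod_one_plus:
  fixes y :: "'i \<Rightarrow> 'a::{real_normed_algebra_1, comm_ring_1}"
  assumes "\<And>i. i \<in> A \<Longrightarrow> norm (y i) \<le> v i"
  shows "norm (\<Prod>i\<in>A. 1 + y i) \<le> exp (sum v A)"
    and "norm ((\<Prod>i\<in>A. 1 + y i) - 1) \<le> exp (sum v A) - 1"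
proof -
  have *: "norm ((\<Prod>i\<in>A. 1 + y i) - 1) \<le> exp (sum v A) - 1"
    using assms
  proof (induction A rule: infinite_finite_induct)
    case (insert x A)
    let ?P = "\<Prod>i\<in>A. 1 + y i"
    have P: "norm (?P - 1) \<le> exp (sum v A) - 1" and y: "norm (y x) \<le> v x"
      using insert by auto
    have "norm (1 + y x) \<le> 1 + v x"
      using norm_triangle_ineq[of 1 "y x"] y by simp
    also have "\<dots> \<le> exp (v x)" by (rule exp_ge_add_one_self)
    finally have e: "norm (1 + y x) \<le> exp (v x)" .
    \<comment> \<open>The product over \<open>insert x A\<close> minus 1 is
      \<open>(1 + y x) * (?P - 1) + y x\<close>.\<close>
    have "norm ((1 + y x) * (?P - 1) + y x) \<le> exp (v x) * (exp (sum v A) - 1) + v x"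
      by (intro order_trans[OF norm_triangle_ineq] add_mono order_trans[OF norm_mult_ineq]
          mult_mono P e y) auto
    also have "\<dots> \<le> exp (v x) * (exp (sum v A) - 1) + (exp (v x) - 1)"
      using exp_ge_add_one_self[of "v x"] by linarith
    also have "\<dots> = exp (sum v (insert x A)) - 1"
      using insert.hyps by (simp add: exp_add algebra_simps)
    finally show ?case
      using insert.hyps by (simp add: algebra_simps)
  qed auto
  then show "norm ((\<Prod>i\<in>A. 1 + y i) - 1) \<le> exp (sum v A) - 1" .
  show "norm (\<Prod>i\<in>A. 1 + y i) \<le> exp (sum v A)"
    using * norm_triangle_ineq[of "(\<Prod>i\<in>A. 1 + y i) - 1" 1] by simp
qed

text \<open>Expand over the set \<open>T\<close> of indices that contribute \<open>X\<close>. The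
  empty \<open>T\<close> leaves \<open>G * (?B J - 1)\<close>, bounded by
  \<open>exp (sum v J) - 1\<close>; for the other \<open>T\<close>, \<open>norm (?B (J - T))\<close>
  is at most \<open>exp (sum v J)\<close> and the factorials are summed by
  \<open>sum_Pow_fact_prod_le\<close>, less the term 1 of the empty set.\<close>

lemma norm_perturbed_prod_le:
  fixes X Y :: "'i \<Rightarrow> 'a::{real_normed_algebra_1, comm_ring_1}"
  assumes J: "finite J" and G: "norm G \<le> 1"
    and Y: "\<And>j. j \<in> J \<Longrightarrow> norm (Y j) \<le> v j"
    and X: "\<And>T. T \<subseteq> J \<Longrightarrow> T \<noteq> {} \<Longrightarrow> norm (G * (\<Prod>j\<in>T. X j)) \<le> K * (fact (card T) * prod u T)"
    and u: "\<And>j. j \<in> J \<Longrightarrow> 0 \<le> u j" "sum u J < 1" and K: "0 \<le> K"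
  shows "norm (G * (\<Prod>j\<in>J. 1 + Y j + X j) - G) \<le> (1 + K * (1 / (1 - sum u J) - 1)) * exp (sum v J) - 1"
proof -
  let ?B = "\<lambda>S. \<Prod>j\<in>S. 1 + Y j" and ?e = "exp (sum v J)"
  have v: "0 \<le> v j" if "j \<in> J" for j
    using Y[OF that] norm_ge_zero[of "Y j"] by linarith
  have B: "norm (?B (J - T)) \<le> ?e" for T
  proof -
    have "norm (?B (J - T)) \<le> exp (sum v (J - T))"
      using Y by (intro norm_prod_one_plus) auto
    also have "\<dots> \<le> ?e"
      using J v by (auto intro!: sum_mono2)
    finally show ?thesis .
  qed
  have "G * (\<Prod>j\<in>J. 1 + Y j + X j) - G =
      (\<Sum>T\<in>Pow J. G * ((\<Prod>j\<in>T. X j) * ?B (J - T))) - G"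
    using J prod_add[of J X "\<lambda>j. 1 + Y j"] by (simp add: add.commute sum_distrib_left)
  also have "\<dots> = (\<Sum>T\<in>Pow J - {{}}. G * (\<Prod>j\<in>T. X j) * ?B (J - T)) + G * (?B J - 1)"
    using J by (subst sum.remove[of _ "{}"]) (auto simp: algebra_simps)
  also have "norm \<dots> \<le> (\<Sum>T\<in>Pow J - {{}}. K * (fact (card T) * prod u T) * ?e) + 1 * (?e - 1)"
    by (intro norm_triangle_le add_mono sum_norm_le order_trans[OF norm_mult_ineq] mult_mono
        X B G norm_prod_one_plus Y)
      (auto intro!: K u prod_nonneg mult_nonneg_nonneg)
  also have "\<dots> = K * (\<Sum>T\<in>Pow J - {{}}. fact (card T) * prod u T) * ?e + (?e - 1)"
    by (simp add: sum_distrib_left sum_distrib_right mult.assoc)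
  also have "\<dots> \<le> K * (1 / (1 - sum u J) - 1) * ?e + (?e - 1)"
  proof -
    have "(\<Sum>T\<in>Pow J. fact (card T) * prod u T) \<le> 1 / (1 - sum u J)"
      using sum_Pow_fact_prod_le[of J u 0] J u by simp
    then have "(\<Sum>T\<in>Pow J - {{}}. fact (card T) * prod u T) \<le> 1 / (1 - sum u J) - 1"
      using J by (subst (asm) sum.remove[of _ "{}"]) auto
    then show ?thesis
      using K by (intro add_right_mono mult_right_mono mult_left_mono) auto
  qed
  finally show ?thesis by (simp add: algebra_simps)
qed

text \<open>For m = \<open>Suc k\<close> this says that the central binomial coefficient is at most
  4^m / 2. The factor 2, available only for m \<ge> 1, is the source of \<open>1 / sqrt 2\<close> in
  \<open>Kerstan_bound\<close>.\<close>

lemma two_fact_double_le: "2 * fact (2 * Suc k) \<le> ((2 ^ Suc k * fact (Suc k))\<^sup>2 :: real)"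
proof (induction k)
  case (Suc k)
  have "fact (2 * Suc (Suc k)) = (2 * real k + 4) * (2 * real k + 3) * fact (2 * Suc k)"
    by (simp add: algebra_simps)
  then have "2 * fact (2 * Suc (Suc k)) = (2 * real k + 4) * (2 * real k + 3) * (2 * fact (2 * Suc k))"
    by simp
  also have "\<dots> \<le> (2 * real k + 4) * (2 * real k + 4) * (2 ^ Suc k * fact (Suc k))\<^sup>2"
    by (intro mult_mono Suc.IH) auto
  also have "\<dots> = (2 ^ Suc (Suc k) * fact (Suc (Suc k)))\<^sup>2"
    by (simp add: power2_eq_square algebra_simps)
  finally show ?case .
qed (simp add: numeral_2_eq_2)

section \<open>The norm bound for an arbitrary splitting of the coordinates\<close>

lemma norm_dirac_minus_1_le: "norm (dirac x - 1 :: 'a::ordered_euclidean_space signed_measure) \<le> 2"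
  using norm_triangle_ineq4[of "dirac x" "1 :: 'a signed_measure"] by simp

text \<open>Indexing by \<open>T \<times> UNIV\<close> with \<open>bool\<close> as second component
  presents a product of squares as a product of twice as many linear forms.\<close>

lemma prod_fst_times_bool:
  fixes f :: "'j \<Rightarrow> 'b::comm_monoid_mult"
  shows "(\<Prod>i\<in>T \<times> (UNIV :: bool set). f (fst i)) = (\<Prod>j\<in>T. f j ^ 2)"
proof -
  have "(\<Prod>i\<in>T \<times> (UNIV :: bool set). f (fst i)) = (\<Prod>j\<in>T. \<Prod>b\<in>(UNIV :: bool set). f j)"
    by (simp only: prod.cartesian_product case_prod_unfold)
  then show ?thesis by simp
qed

text \<open>The sets \<open>A j\<close> select the coordinates treated by Bessel's inequality; the
  others are estimated by total variation. They are left free because the two final bounds cut at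
  different thresholds.\<close>

lemma Kerstan_bound:
  fixes x :: "'r::finite \<Rightarrow> 'a::ordered_euclidean_space" and p :: "'j \<Rightarrow> real" and q :: "'j \<Rightarrow> 'r \<Rightarrow> real"
    and A :: "'j \<Rightarrow> 'r set"
  assumes J: "finite J" and p: "\<And>j. j \<in> J \<Longrightarrow> 0 \<le> p j" and q: "\<And>j r. j \<in> J \<Longrightarrow> 0 \<le> q j r"
    and q1: "\<And>j. j \<in> J \<Longrightarrow> (\<Sum>r\<in>UNIV. q j r) = 1"
    and l: "\<And>r. l r = (\<Sum>j\<in>J. p j * q j r)" "\<And>r. 0 < l r"
    and a: "a = (\<Sum>j\<in>J. g (2 * p j) * (p j)\<^sup>2 * (\<Sum>r\<in>A j. (q j r)\<^sup>2 / l r))" "a < 1"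
    and b: "b = (\<Sum>j\<in>J. g (2 * p j) * (p j)\<^sup>2 * (\<Sum>r\<in>- A j. q j r))"
  shows "norm ((\<Prod>j\<in>J. dirac 0 + p j *\<^sub>R (\<Sum>r\<in>UNIV. q j r *\<^sub>R (dirac (x r) - dirac 0)))
      - exp (\<Sum>r\<in>UNIV. l r *\<^sub>R (dirac (x r) - dirac 0)))
    \<le> (1 + 1 / sqrt 2 * (1 / (1 - a) - 1)) * exp (4 * b) - 1"
proof -
  define D where "D r = dirac (x r) - 1" for r
  define Q where "Q j = (\<Sum>r\<in>UNIV. q j r *\<^sub>R D r)" for j
  define U where "U j = (\<Sum>r\<in>A j. q j r *\<^sub>R D r)" for j
  define W where "W j = (\<Sum>r\<in>- A j. q j r *\<^sub>R D r)" for j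
  define w where "w j = (\<Sum>r\<in>- A j. q j r)" for j
  define s where "s j = (\<Sum>r\<in>A j. (q j r)\<^sup>2 / l r)" for j
  define z where "z j = p j *\<^sub>R Q j" for j
  define G where "G = exp (\<Sum>r\<in>UNIV. l r *\<^sub>R D r)"
  have nD: "norm (D r) \<le> 2" for r
    by (simp add: D_def norm_dirac_minus_1_le)
  have nsum: "norm (\<Sum>r\<in>B. q j r *\<^sub>R D r) \<le> 2 * (\<Sum>r\<in>B. q j r)" if "j \<in> J" for B j
  proof -
    have "norm (\<Sum>r\<in>B. q j r *\<^sub>R D r) \<le> (\<Sum>r\<in>B. q j r * 2)"
      using q[OF that] nD by (intro sum_norm_le) (simp add: mult_left_mono)
    then show ?thesis by (simp add: sum_distrib_left mult.commute)
  qed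
  have split: "(\<Sum>r\<in>UNIV. f r) = (\<Sum>r\<in>A j. f r) + (\<Sum>r\<in>- A j. f r)" for f :: "'r \<Rightarrow> 'b::comm_monoid_add" and j
    by (subst sum.union_disjoint[symmetric]) auto
  have QUW: "Q j = U j + W j" for j
    unfolding Q_def U_def W_def by (rule split)
  have w: "0 \<le> w j" "(\<Sum>r\<in>A j. q j r) = 1 - w j" "norm (W j) \<le> 2 * w j" "norm (U j) \<le> 2 * (1 - w j)"
    if "j \<in> J" for j
  proof -
    show "0 \<le> w j" unfolding w_def by (intro sum_nonneg q that)
    show "(\<Sum>r\<in>A j. q j r) = 1 - w j"
      using split[of "q j" j] q1[OF that] by (simp add: w_def)
    then show "norm (W j) \<le> 2 * w j" "norm (U j) \<le> 2 * (1 - w j)"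
      using nsum[OF that, of "A j"] nsum[OF that, of "- A j"] by (simp_all add: W_def U_def w_def)
  qed
  have s: "0 \<le> s j" for j
    unfolding s_def using l by (intro sum_nonneg) (simp add: less_imp_le)
  have nz: "norm (z j) \<le> 2 * p j" if "j \<in> J" for j
    using nsum[OF that, of UNIV] q1[OF that] p[OF that]
    by (simp add: z_def Q_def mult_left_mono mult.commute[of 2])
  have "\<exists>R. exp (- z j) * (1 + z j) = 1 - (z j)\<^sup>2 * R \<and> norm R \<le> g (norm (z j)) / 2" for j
    by (rule Kerstan_remainder)
  then obtain R where R: "\<And>j. exp (- z j) * (1 + z j) = 1 - (z j)\<^sup>2 * R j"
    and nR': "\<And>j. norm (R j) \<le> g (norm (z j)) / 2"
    by metis
  have nR: "norm (R j) \<le> g (2 * p j) / 2" if "j \<in> J" for j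
    using nR'[of j] g_mono[OF norm_ge_zero nz[OF that]] by simp
  define H where "H j = - ((p j)\<^sup>2 *\<^sub>R R j)" for j
  have nH: "norm (H j) \<le> (p j)\<^sup>2 * (g (2 * p j) / 2)" if "j \<in> J" for j
    using mult_left_mono[OF nR[OF that], of "(p j)\<^sup>2"] by (simp add: H_def)
  \<comment> \<open>With \<open>Q j = U j + W j\<close>, the square \<open>(Q j)\<^sup>2\<close> is
    \<open>(U j)\<^sup>2\<close> plus \<open>W j * (2 *\<^sub>R U j + W j)\<close>; only the first
    summand needs the smoothing by \<open>G\<close>.\<close>
  define X where "X j = (U j)\<^sup>2 * H j" for j
  define Y where "Y j = W j * (2 *\<^sub>R U j + W j) * H j" for j
  have XY: "exp (- z j) * (1 + z j) = 1 + Y j + X j" for j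
    unfolding R by (simp add: X_def Y_def H_def z_def QUW power2_eq_square algebra_simps scaleR_2)
  have nY: "norm (Y j) \<le> 4 * (g (2 * p j) * (p j)\<^sup>2 * w j)" if "j \<in> J" for j
  proof -
    \<comment> \<open>The bounds on \<open>U j\<close> and \<open>W j\<close> give at most
      \<open>4 * (1 - w j) + 2 * w j\<close>.\<close>
    have "norm (2 *\<^sub>R U j + W j) \<le> 4"
      using norm_triangle_ineq[of "2 *\<^sub>R U j" "W j"] w[OF that] by simp
    then have "norm (Y j) \<le> (2 * w j) * 4 * ((p j)\<^sup>2 * (g (2 * p j) / 2))"
      unfolding Y_def using w[OF that] nH[OF that]
      by (intro order_trans[OF norm_mult_ineq] mult_mono) auto
    then show ?thesis by (simp add: mult_ac)
  qed
  have nX: "norm (G * (\<Prod>j\<in>T. X j)) \<le> 1 / sqrt 2 * (fact (card T) * (\<Prod>j\<in>T. g (2 * p j) * (p j)\<^sup>2 * s j))"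
    if T: "T \<subseteq> J" "T \<noteq> {}" for T
  proof -
    have fT: "finite T" using T J finite_subset by blast
    then obtain k where k: "card T = Suc k"
      using T by (metis card_eq_0_iff not0_implies_Suc)
    \<comment> \<open>Coefficients are cut off outside \<open>A j\<close>, and each index
      \<open>j\<close> occurs twice, so the linear forms multiply to the squares of the
      \<open>U j\<close>.\<close>
    define c where "c i r = (if r \<in> A (fst i) then q (fst i) r else 0)" for i :: "'j \<times> bool" and r
    have c: "(\<Sum>r\<in>UNIV. c i r *\<^sub>R (dirac (x r) - 1)) = U (fst i)"
      "(\<Sum>r\<in>UNIV. (c i r)\<^sup>2 / l r) = s (fst i)" for i
      unfolding U_def D_def s_def c_def by (rule sum.mono_neutral_cong_right; simp)+
    have "(norm (G * (\<Prod>i\<in>T \<times> (UNIV :: bool set). U (fst i))))\<^sup>2 \<le> fact (card (T \<times> (UNIV :: bool set))) * (\<Prod>i\<in>T \<times> (UNIV :: bool set). s (fst i))"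
      using norm_Poisson_times_differences[of l "T \<times> (UNIV :: bool set)" x c] l(2) fT
      unfolding c by (simp add: G_def D_def)
    also have "\<dots> = fact (2 * Suc k) * (\<Prod>j\<in>T. s j)\<^sup>2"
      by (simp add: card_cartesian_product k prod_power_distrib mult.commute[of _ 2]
          prod_fst_times_bool del: fact_Suc mult_Suc_right)
    also have "(\<Prod>i\<in>T \<times> (UNIV :: bool set). U (fst i)) = (\<Prod>j\<in>T. (U j)\<^sup>2)"
      by (rule prod_fst_times_bool)
    also have "fact (2 * Suc k) * (\<Prod>j\<in>T. s j)\<^sup>2 \<le> (2 ^ Suc k * fact (Suc k))\<^sup>2 / 2 * (\<Prod>j\<in>T. s j)\<^sup>2"
      using two_fact_double_le[of k] by (intro mult_right_mono) auto
    also have "\<dots> = (1 / sqrt 2 * (2 ^ Suc k * fact (Suc k)) * (\<Prod>j\<in>T. s j))\<^sup>2"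
      by (simp add: power_mult_distrib power_divide)
    finally have GU: "norm (G * (\<Prod>j\<in>T. (U j)\<^sup>2)) \<le> 1 / sqrt 2 * (2 ^ Suc k * fact (Suc k)) * (\<Prod>j\<in>T. s j)"
      by (rule power2_le_imp_le) (simp add: prod_nonneg s)
    have HT: "norm (\<Prod>j\<in>T. H j) \<le> (\<Prod>j\<in>T. (p j)\<^sup>2 * (g (2 * p j) / 2))"
      using T nH by (intro order_trans[OF norm_prod_le] prod_mono) auto
    have "norm (G * (\<Prod>j\<in>T. (U j)\<^sup>2) * (\<Prod>j\<in>T. H j)) \<le>
        (1 / sqrt 2 * (2 ^ Suc k * fact (Suc k)) * (\<Prod>j\<in>T. s j)) * (\<Prod>j\<in>T. (p j)\<^sup>2 * (g (2 * p j) / 2))"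
      by (rule order_trans[OF norm_mult_ineq mult_mono[OF GU HT]]) (simp_all add: prod_nonneg s)
    \<comment> \<open>The \<open>2 ^ Suc k\<close> coming from the square root of
      \<open>fact (2 * Suc k)\<close> cancels the halves in the bounds for the
      \<open>H j\<close>.\<close>
    also have "\<dots> = 1 / sqrt 2 * (fact (card T) * (\<Prod>j\<in>T. 2 * (s j * ((p j)\<^sup>2 * (g (2 * p j) / 2)))))"
      unfolding prod.distrib by (simp add: k)
    finally show ?thesis
      by (simp add: X_def prod.distrib mult_ac)
  qed
  have L: "(\<Sum>r\<in>UNIV. l r *\<^sub>R D r) = (\<Sum>j\<in>J. z j)"
  proof -
    have "(\<Sum>r\<in>UNIV. l r *\<^sub>R D r) = (\<Sum>r\<in>UNIV. \<Sum>j\<in>J. p j *\<^sub>R q j r *\<^sub>R D r)"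
      by (simp add: l(1) scaleR_sum_left)
    also have "\<dots> = (\<Sum>j\<in>J. z j)"
      by (subst sum.swap) (simp add: z_def Q_def scaleR_sum_right)
    finally show ?thesis .
  qed
  \<comment> \<open>By \<open>L\<close>, \<open>G\<close> is the product of the
    \<open>exp (z j)\<close>, which cancel the \<open>exp (- z j)\<close> in
    \<open>XY\<close>.\<close>
  have "G * (\<Prod>j\<in>J. 1 + Y j + X j) = (\<Prod>j\<in>J. exp (z j) * (exp (- z j) * (1 + z j)))"
    using J by (simp add: G_def L exp_sum XY prod.distrib)
  also have "\<dots> = (\<Prod>j\<in>J. 1 + z j)"
    by (simp add: exp_minus_inverse flip: mult.assoc)
  finally have F: "G * (\<Prod>j\<in>J. 1 + Y j + X j) = (\<Prod>j\<in>J. 1 + z j)" .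
  have "norm (G * (\<Prod>j\<in>J. 1 + Y j + X j) - G) \<le>
      (1 + 1 / sqrt 2 * (1 / (1 - (\<Sum>j\<in>J. g (2 * p j) * (p j)\<^sup>2 * s j)) - 1)) *
      exp (\<Sum>j\<in>J. 4 * (g (2 * p j) * (p j)\<^sup>2 * w j)) - 1"
  proof (rule norm_perturbed_prod_le[OF J _ nY nX])
    show "norm G \<le> 1"
      unfolding G_def D_def using l(2) by (intro norm_exp_dirac_le_1) (auto simp: less_imp_le)
    show "0 \<le> g (2 * p j) * (p j)\<^sup>2 * s j" if "j \<in> J" for j
      using g_ge_1[of "2 * p j"] p[OF that] s by simp
    show "(\<Sum>j\<in>J. g (2 * p j) * (p j)\<^sup>2 * s j) < 1"
      using a by (simp add: s_def)
  qed auto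
  then show ?thesis
    unfolding F
    by (simp add: a(1) b s_def w_def G_def z_def Q_def D_def sum_distrib_left
        flip: one_signed_measure_def)
qed

subsection \<open>Numerical estimates\<close>

text \<open>Each factor is a convex combination of Dirac measures.\<close>

lemma norm_Bernoulli_factor_le_1:
  fixes x :: "'r::finite \<Rightarrow> 'a::ordered_euclidean_space"
  assumes p: "0 \<le> p" "p \<le> 1" and q: "\<And>r. 0 \<le> q r" "(\<Sum>r\<in>UNIV. q r) = 1"
  shows "norm (dirac 0 + p *\<^sub>R (\<Sum>r\<in>UNIV. q r *\<^sub>R (dirac (x r) - dirac 0))) \<le> 1"
proof -
  have "dirac 0 + p *\<^sub>R (\<Sum>r\<in>UNIV. q r *\<^sub>R (dirac (x r) - dirac 0)) =
      (1 - p) *\<^sub>R dirac 0 + p *\<^sub>R (\<Sum>r\<in>UNIV. q r *\<^sub>R dirac (x r))"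
    using q(2) by (simp add: scaleR_diff_right sum_subtractf scaleR_diff_left flip: scaleR_sum_left)
  also have "norm \<dots> \<le> (1 - p) * 1 + p * 1"
  proof (intro norm_triangle_le add_mono)
    have "norm (\<Sum>r\<in>UNIV. q r *\<^sub>R dirac (x r)) \<le> (\<Sum>r\<in>UNIV. q r)"
      using q(1) by (intro sum_norm_le) simp
    then show "norm (p *\<^sub>R (\<Sum>r\<in>UNIV. q r *\<^sub>R dirac (x r))) \<le> p * 1"
      using p q(2) by (simp add: mult_left_le)
  qed (use p in simp)
  finally show ?thesis by simp
qed

text \<open>Here \<open>a\<close> and \<open>b\<close> are the parts of
  \<open>\<alpha>\<^sub>1\<close> from inside and outside the \<open>A j\<close>. For
  \<open>b = 0\<close> both sides agree; the exponential is absorbed through exp y \<le> 1 / (1 - y)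
  at y = \<open>2 * b\<close>, using 2 \<le> 2 * sqrt 2.\<close>

lemma small_alpha_estimate:
  fixes a b :: real
  assumes a: "0 \<le> a" and b: "0 \<le> b" and ab: "a + b < 1 / (2 * sqrt 2)"
  shows "(1 + 1 / sqrt 2 * (1 / (1 - 2 * sqrt 2 * a) - 1)) * exp (2 * b) - 1
    \<le> 2 * (a + b) / (1 - 2 * sqrt 2 * (a + b))"
proof -
  define s where "s = 2 * sqrt 2"
  define Y where "Y = 1 - s * a"
  define Z where "Z = 1 - s * (a + b)"
  have "1 \<le> sqrt 2" by simp
  then have s: "2 \<le> s" unfolding s_def by linarith
  have Z: "0 < Z"
    using ab s by (simp add: Z_def s_def field_simps)
  have "0 \<le> s * a" "0 \<le> s * b" "2 * b \<le> s * b"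
    using s a b by (auto intro: mult_right_mono)
  then have Y: "0 < Y" and b2: "0 < 1 - 2 * b"
    using Z by (auto simp: Z_def Y_def distrib_left)
  have "1 - 2 * b \<le> exp (- (2 * b))"
    using exp_ge_add_one_self[of "- (2 * b)"] by simp
  then have e: "exp (2 * b) \<le> 1 / (1 - 2 * b)"
    using b2 by (simp add: exp_minus field_simps)
  have "1 / sqrt 2 * (1 / Y - 1) = 2 * a / Y"
  proof -
    have "1 / sqrt 2 * (1 / Y - 1) = (1 - Y) / sqrt 2 / Y"
      using Y by (simp add: field_simps)
    also have "(1 - Y) / sqrt 2 = 2 * a"
      by (simp add: Y_def s_def)
    finally show ?thesis .
  qed
  moreover have "1 + 2 * a / Y = (Y + 2 * a) / Y"
    using Y by (simp add: field_simps)
  ultimately have "(1 + 1 / sqrt 2 * (1 / Y - 1)) * exp (2 * b) = (Y + 2 * a) / Y * exp (2 * b)"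
    by simp
  also have "\<dots> \<le> (Y + 2 * a) / Y * (1 / (1 - 2 * b))"
    using Y a e by (intro mult_left_mono) auto
  also have "\<dots> \<le> (Z + 2 * (a + b)) / Z"
  proof -
    \<comment> \<open>Cross-multiplied difference; every summand in the bracket is nonnegative
      because 2 \<le> \<open>s\<close>.\<close>
    have "(Z + 2 * (a + b)) * (Y * (1 - 2 * b)) - (Y + 2 * a) * Z =
        2 * b * (Y * ((s - 2) * a) + Y * (b * (s - 2)) + s * a)"
      by (simp add: Z_def Y_def algebra_simps)
    also have "\<dots> \<ge> 0"
      using a b s Y by (intro mult_nonneg_nonneg add_nonneg_nonneg) auto
    finally have "(Y + 2 * a) * Z \<le> (Z + 2 * (a + b)) * (Y * (1 - 2 * b))" by simp
    then show ?thesis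
      using Y Z b2 by (simp add: frac_le_eq divide_le_eq le_divide_eq pos_divide_le_eq mult_ac)
  qed
  also have "\<dots> = 1 + 2 * (a + b) / Z"
    using Z by (simp add: field_simps)
  finally show ?thesis
    by (simp add: Y_def Z_def s_def)
qed

text \<open>Convexity of \<open>exp\<close>: the chord reaches the value 3 at 40/39, since 1.95 *
  40/39 = 2.\<close>

lemma exp_le_chord:
  assumes "0 \<le> y" "y \<le> 40 / 39"
  shows "exp y \<le> 1 + 1.95 * (y :: real)"
proof -
  define t where "t = y * 39 / 40"
  have t: "0 \<le> t" "t \<le> 1" using assms by (auto simp: t_def)
  have "exp (40 / 39 :: real) = exp 1 * exp (1 / 39)"
    by (simp flip: exp_add)
  also have "exp (1 / 39 :: real) \<le> 39 / 38"
    using exp_ge_add_one_self[of "- (1 / 39) :: real"] by (simp add: exp_minus field_simps)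
  finally have "exp (40 / 39 :: real) \<le> exp 1 * (39 / 38)" by simp
  also have "\<dots> \<le> 3" using e_less_272 by simp
  finally have e: "exp (40 / 39 :: real) \<le> 3" .
  have "exp ((1 - t) *\<^sub>R 0 + t *\<^sub>R (40 / 39)) \<le> (1 - t) * exp 0 + t * exp (40 / 39 :: real)"
    using t by (intro convex_onD[OF exp_convex]) auto
  also have "\<dots> \<le> (1 - t) * 1 + t * 3"
    using t e by (intro add_left_mono mult_left_mono add_mono) auto
  finally show ?thesis
    by (simp add: t_def)
qed

text \<open>The left side plus 1 is at most \<open>exp (8 * (a / 5.2 + b / 2))\<close>, as 8 / 5.2 =
  20/13. Then \<open>8 * c\<close> is below 16 / 15.6 = 40/39, and 15.6 = 8 * 1.95.\<close>

lemma small_beta_estimate: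
  fixes a b c :: real
  assumes a: "0 \<le> a" and b: "0 \<le> b" and c: "a / 5.2 + b / 2 \<le> c" "c < 2 / 15.6"
  shows "(1 + 1 / sqrt 2 * (1 / (1 - a) - 1)) * exp (4 * b) - 1 \<le> 15.6 * c"
proof -
  \<comment> \<open>The bound is 5.2 * 2 / 15.6.\<close>
  have a1: "a < 2 / 3" using a b c by simp
  have "625 / 442 \<le> sqrt 2"
    by (rule real_le_rsqrt) (simp add: power2_eq_square)
  then have "1 / sqrt 2 \<le> 442 / 625"
    by (simp add: divide_le_eq)
  have "1 + 1 / sqrt 2 * (1 / (1 - a) - 1) \<le> 1 + 442 / 625 * (1 / (1 - a) - 1)"
    using a a1 \<open>1 / sqrt 2 \<le> 442 / 625\<close> by (intro add_left_mono mult_right_mono) (auto simp: field_simps)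
  also have "\<dots> \<le> 1 + 20 / 13 * a + (20 / 13 * a)\<^sup>2 / 2"
  proof -
    \<comment> \<open>Multiplied by \<open>a\<close> and divided by \<open>1 - a\<close>, this is
      the comparison with the quadratic Taylor polynomial of \<open>exp (20 / 13 * a)\<close>;
      442/625 is a rational upper bound of \<open>1 / sqrt 2\<close>.\<close>
    have "442 / 625 \<le> (20 / 13 + 200 / 169 * a) * (1 - a)"
    proof -
      have "a * a \<le> a * (2 / 3)" using a a1 by (intro mult_left_mono) auto
      moreover have "(20 / 13 + 200 / 169 * a) * (1 - a) = 20 / 13 - 60 / 169 * a - 200 / 169 * (a * a)"
        by (simp add: field_simps)
      ultimately show ?thesis using a1 by linarith
    qed
    then have "a * (442 / 625) \<le> a * ((20 / 13 + 200 / 169 * a) * (1 - a))"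
      using a by (intro mult_left_mono)
    then have "442 / 625 * (a / (1 - a)) \<le> a * (20 / 13 + 200 / 169 * a)"
      using a1 by (simp add: field_simps)
    moreover have "1 / (1 - a) - 1 = a / (1 - a)"
      using a1 by (simp add: field_simps)
    ultimately show ?thesis by (simp add: power2_eq_square algebra_simps)
  qed
  also have "\<dots> \<le> exp (20 / 13 * a)"
    using a by (intro exp_lower_Taylor_quadratic) simp
  finally have "(1 + 1 / sqrt 2 * (1 / (1 - a) - 1)) * exp (4 * b) \<le> exp (20 / 13 * a) * exp (4 * b)"
    by (intro mult_right_mono) auto
  also have "\<dots> \<le> exp (8 * c)"
    using c by (simp flip: exp_add)
  also have "\<dots> \<le> 1 + 15.6 * c"
    using a b c exp_le_chord[of "8 * c"] by simp
  finally show ?thesis by linarith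
qed

section \<open>Special values of \<open>g\<close> and the two bounds of the theorem\<close>

lemma g_at_1: "g (1 :: real) = 2"
  using g_closed_form[of "1 :: real"] by (simp add: exp_minus)

text \<open>The closed form gives \<open>g 2 = (1 + exp 2) / 2\<close>.\<close>

lemma g_at_2_le: "g (2 :: real) \<le> 4.2"
proof -
  have "exp 2 = (exp 1 :: real)\<^sup>2"
    by (simp flip: exp_double)
  also have "\<dots> \<le> 2.72\<^sup>2"
    using e_less_272 by (intro power_mono) auto
  finally have "exp (2 :: real) \<le> 7.4"
    by (simp add: power2_eq_square)
  then show ?thesis
    using g_closed_form[of "2 :: real"] by (simp add: exp_minus algebra_simps)
qed

theorem theorem1p1:
  fixes n :: nat and p :: "nat \<Rightarrow> real" and q :: "nat \<Rightarrow> 'd::finite \<Rightarrow> real"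
    and lam :: "'d \<Rightarrow> real" and F G :: "(real ^ 'd) signed_measure" and \<alpha>\<^sub>1 \<beta>\<^sub>1 :: real
  assumes "n \<ge> 1"
    and "\<And>j. j \<in> {1..n} \<Longrightarrow> p j \<in> {0..1}"
    and "\<And>j r. j \<in> {1..n} \<Longrightarrow> q j r \<in> {0..1}"
    and "\<And>j. j \<in> {1..n} \<Longrightarrow> (\<Sum>r\<in>UNIV. q j r) = 1"
    and "\<And>r. lam r = (\<Sum>j=1..n. p j * q j r)"
    and "\<And>r. lam r > 0"
    and "F = (\<Prod>j=1..n. dirac 0 + p j *\<^sub>R (\<Sum>r\<in>UNIV. q j r *\<^sub>R (dirac (axis r 1) - dirac 0)))"
    and "G = exp (\<Sum>r\<in>UNIV. lam r *\<^sub>R (dirac (axis r 1) - dirac 0))"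
    and "\<alpha>\<^sub>1 = (\<Sum>j=1..n. g (2 * p j) * (p j)\<^sup>2 *
           (\<Sum>r\<in>UNIV. q j r * min (q j r / (2 powr (3/2) * lam r)) 2))"
    and "\<beta>\<^sub>1 = (\<Sum>j=1..n. (p j)\<^sup>2 * (\<Sum>r\<in>UNIV. q j r * min (q j r / lam r) 1))"
  shows "(\<alpha>\<^sub>1 < 1 / 2 powr (3/2) \<longrightarrow> norm (F - G) \<le> 2 * \<alpha>\<^sub>1 / (1 - 2 powr (3/2) * \<alpha>\<^sub>1)) \<and>
         norm (F - G) \<le> 15.6 * \<beta>\<^sub>1"
proof -
  let ?s = "2 powr (3/2) :: real"
  have s: "?s = 2 * sqrt 2"
    using powr_add[of 2 1 "1 / 2 :: real"] by (simp add: powr_half_sqrt)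
  note lam = assms(6)
  have p: "0 \<le> p j" "p j \<le> 1" and q: "0 \<le> q j r" if "j \<in> {1..n}" for j r
    using assms(2,3)[OF that] by auto
  have w: "0 \<le> g (2 * p j) * (p j)\<^sup>2" if "j \<in> {1..n}" for j
    using g_ge_1[of "2 * p j"] p[OF that] by simp
  have split: "(\<Sum>r\<in>UNIV. f r) = (\<Sum>r\<in>A. f r) + (\<Sum>r\<in>- A. f r)" for f :: "'d \<Rightarrow> real" and A
    by (subst sum.union_disjoint[symmetric]) auto
  define a b where
    "a A = (\<Sum>j=1..n. g (2 * p j) * (p j)\<^sup>2 * (\<Sum>r\<in>A j. (q j r)\<^sup>2 / lam r))" and
    "b A = (\<Sum>j=1..n. g (2 * p j) * (p j)\<^sup>2 * (\<Sum>r\<in>- A j. q j r))" for A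
  have a0: "0 \<le> a A" and b0: "0 \<le> b A" for A
    unfolding a_def b_def using w q lam
    by (auto intro!: sum_nonneg mult_nonneg_nonneg[of "g _ * _"] simp: less_imp_le)
  have bound: "norm (F - G) \<le> (1 + 1 / sqrt 2 * (1 / (1 - a A) - 1)) * exp (4 * b A) - 1"
    if "a A < 1" for A
    unfolding assms(7,8) using p q assms(4-6) that
    by (intro Kerstan_bound[where A = A]) (auto simp: a_def b_def)
  have "norm (F - G) \<le> 2 * \<alpha>\<^sub>1 / (1 - ?s * \<alpha>\<^sub>1)" if \<alpha>: "\<alpha>\<^sub>1 < 1 / ?s"
  proof -
    \<comment> \<open>These are the coordinates where the minimum in \<open>\<alpha>\<^sub>1\<close>
      is its first argument, so \<open>\<alpha>\<^sub>1\<close> splits exactly into the quantities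
      \<open>a A\<close> and \<open>b A\<close>.\<close>
    define A where "A j = {r. q j r / (?s * lam r) \<le> 2}" for j
    have "(\<Sum>r\<in>UNIV. q j r * min (q j r / (?s * lam r)) 2) =
        (\<Sum>r\<in>A j. (q j r)\<^sup>2 / lam r) / ?s + 2 * (\<Sum>r\<in>- A j. q j r)" for j
      unfolding split[of _ "A j"] sum_divide_distrib sum_distrib_left
      by (intro arg_cong2[where f = "(+)"] sum.cong)
        (auto simp: A_def power2_eq_square min_def mult_ac)
    moreover have "(\<Sum>j=1..n. c j * (f j / ?s + 2 * h j)) =
        (\<Sum>j=1..n. c j * f j) / ?s + 2 * (\<Sum>j=1..n. c j * h j)" for c f h :: "nat \<Rightarrow> real"
      by (simp add: distrib_left sum.distrib sum_divide_distrib sum_distrib_left mult_ac)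
    ultimately have "\<alpha>\<^sub>1 = a A / ?s + 2 * b A"
      by (simp only: assms(9) a_def b_def)
    then have \<alpha>_eq: "\<alpha>\<^sub>1 = a A / (2 * sqrt 2) + 2 * b A"
      by (simp only: s)
    then have "2 * sqrt 2 * \<alpha>\<^sub>1 = a A + 2 * sqrt 2 * (2 * b A)"
      by (simp add: distrib_left)
    moreover have "2 * sqrt 2 * \<alpha>\<^sub>1 < 1"
      using \<alpha> unfolding s by (simp add: less_divide_eq mult.commute)
    moreover have "0 \<le> 2 * sqrt 2 * (2 * b A)"
      using b0 by simp
    ultimately have "a A < 1" by linarith
    note bound[OF this]
    also have "(1 + 1 / sqrt 2 * (1 / (1 - a A) - 1)) * exp (4 * b A) - 1 \<le>
        2 * \<alpha>\<^sub>1 / (1 - 2 * sqrt 2 * \<alpha>\<^sub>1)"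
      using small_alpha_estimate[of "a A / (2 * sqrt 2)" "2 * b A"] a0[of A] b0[of A] \<alpha>
      unfolding s \<alpha>_eq by simp
    finally show ?thesis by (simp only: s)
  qed
  \<comment> \<open>If \<open>15.6 * \<beta>\<^sub>1 \<ge> 2\<close>, the triangle inequality
    suffices, as \<open>F\<close> and \<open>G\<close> have norm at most 1.\<close>
  moreover have "norm (F - G) \<le> 15.6 * \<beta>\<^sub>1"
  proof (cases "\<beta>\<^sub>1 < 2 / 15.6")
    case True
    \<comment> \<open>Off \<open>A j\<close> the threshold 2 forces \<open>p j < 1 / 2\<close>, whence \<open>g (2 * p j) \<le> g 1 = 2\<close>.\<close>
    define A where "A j = {r. q j r \<le> 2 * lam r}" for j
    \<comment> \<open>A single summand of \<open>lam r\<close> is at most the sum; hence a large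
      ratio \<open>q j r / lam r\<close> forces \<open>p j\<close> to be small.\<close>
    have pq: "p j * q j r \<le> lam r" if "j \<in> {1..n}" for j r
      unfolding assms(5) using that p q by (intro member_le_sum) auto
    \<comment> \<open>With x = \<open>q j r / lam r\<close>: for x \<le> 1 the value 4.2 of the
      bound on \<open>g\<close> is enough; for 1 < x \<le> 2 the chord bound 1 + 3.2 *
      \<open>p j\<close> and \<open>p j\<close> * x \<le> 1 give 2 + 3.2 = 5.2.\<close>
    have in_A: "g (2 * p j) * ((q j r)\<^sup>2 / lam r) / 5.2 \<le> q j r * min (q j r / lam r) 1"
      if j: "j \<in> {1..n}" and r: "r \<in> A j" for j r
    proof -
      define x where "x = q j r / lam r"
      have x: "0 \<le> x" "x \<le> 2" "p j * x \<le> 1"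
        using lam[of r] q[OF j] pq[OF j, of r] r by (auto simp: x_def A_def field_simps)
      have "g (2 * p j) * x \<le> 5.2 * min x 1"
      proof (cases "x \<le> 1")
        case True
        have "g (2 * p j) \<le> 4.2"
          using g_mono[of "2 * p j" 2] p[OF j] g_at_2_le by simp
        with True x show ?thesis using mult_right_mono[of "g (2 * p j)" "5.2" x] by simp
      next
        case False
        have "p j * (g 2 - 1) \<le> p j * 3.2"
          using p[OF j] g_at_2_le by (intro mult_left_mono) auto
        then have "g (2 * p j) \<le> 1 + 3.2 * p j"
          using g_le_chord[of "p j" 2] p[OF j] by (simp add: mult.commute)
        then have "g (2 * p j) * x \<le> (1 + 3.2 * p j) * x"
          using x by (intro mult_right_mono)
        also have "\<dots> = x + 3.2 * (p j * x)" by (simp add: algebra_simps)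
        finally show ?thesis using False x by simp
      qed
      from mult_left_mono[OF this q[OF j, of r]]
      have "g (2 * p j) * ((q j r)\<^sup>2 / lam r) \<le> 5.2 * (q j r * min (q j r / lam r) 1)"
        by (simp add: x_def power2_eq_square mult_ac)
      then show ?thesis by (subst pos_divide_le_eq) (simp_all add: mult_ac)
    qed
    have notin_A: "g (2 * p j) * q j r / 2 \<le> q j r * min (q j r / lam r) 1"
      if j: "j \<in> {1..n}" and r: "r \<in> - A j" for j r
    proof -
      have q2: "2 * lam r < q j r" using r by (simp add: A_def)
      then have "p j * (2 * lam r) \<le> lam r"
        using pq[OF j, of r] mult_left_mono[of "2 * lam r" "q j r" "p j"] p[OF j] by simp
      then have "2 * p j \<le> 1" using lam[of r] by simp
      then have "g (2 * p j) \<le> 2"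
        using g_mono[of "2 * p j" 1] p[OF j] by (simp add: g_at_1)
      moreover have "min (q j r / lam r) 1 = 1"
        using q2 lam[of r] by (simp add: min_def field_simps)
      ultimately show ?thesis using q[OF j, of r] mult_right_mono[of "g (2 * p j)" 2 "q j r"] by simp
    qed
    have "a A / 5.2 + b A / 2 = (\<Sum>j=1..n. (p j)\<^sup>2 *
        ((\<Sum>r\<in>A j. g (2 * p j) * ((q j r)\<^sup>2 / lam r) / 5.2) + (\<Sum>r\<in>- A j. g (2 * p j) * q j r / 2)))"
      by (simp add: a_def b_def sum_divide_distrib sum_distrib_left sum_distrib_right sum.distrib
          distrib_left mult_ac)
    also have "\<dots> \<le> \<beta>\<^sub>1"
      unfolding assms(10)
    proof (intro sum_mono mult_left_mono)
      fix j assume j: "j \<in> {1..n}"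
      show "(\<Sum>r\<in>A j. g (2 * p j) * ((q j r)\<^sup>2 / lam r) / 5.2) + (\<Sum>r\<in>- A j. g (2 * p j) * q j r / 2)
          \<le> (\<Sum>r\<in>UNIV. q j r * min (q j r / lam r) 1)"
        unfolding split[of _ "A j"]
        by (intro add_mono sum_mono in_A notin_A j)
    qed simp
    finally have c: "a A / 5.2 + b A / 2 \<le> \<beta>\<^sub>1" .
    with True b0[of A] have "a A < 1" by simp
    from bound[OF this] small_beta_estimate[OF a0 b0 c True] show ?thesis by linarith
  next
    case False
    have "norm F \<le> (\<Prod>j=1..n. 1)"
      unfolding assms(7) using p q assms(4)
      by (intro order_trans[OF norm_prod_le] prod_mono conjI norm_Bernoulli_factor_le_1) auto
    moreover have "norm G \<le> 1"
      unfolding assms(8) using lam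
      by (auto simp: less_imp_le simp flip: one_signed_measure_def intro!: norm_exp_dirac_le_1)
    ultimately show ?thesis
      using norm_triangle_ineq4[of F G] False by simp
  qed
  ultimately show ?thesis by blast
qed

end
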